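(* Let $Z$ be a Gaussian process on a compact metric space $D$ with continuous trajectories, with mean function $m$ and covariance function $k$. Consider two observation operators $G_1:C(D)\to\mathbb{R}^{p_1}$, $(G_1Z)_i=\int_DZ_s\,d\lambda_i^{(1)}(s)$, and $G_2:C(D)\to\mathbb{R}^{p_2}$, $(G_2Z)_i=\int_DZ_s\,d\lambda_i^{(2)}(s)$, where the $\lambda_i^{(1)},\lambda_i^{(2)}$ are Radon measures on $D$. Assume that the matrices $K_{G_1G_1}$ and $\tilde K^{(1)}_{G_2G_2}$ defined in the context are invertible. Let $G:=(G_1,G_2)$. Then for any $y=(y_1,y_2)\in\mathbb{R}^{p_1+p_2}$ and any $s,s_1,s_2\in D$, the conditional mean $\tilde m_s(y)$ and conditional covariance $\tilde k(s_1,s_2)$ of $Z$ given $GZ=y$ satisfy $$\tilde m_s(y)=m_s+K_{sG_1}K_{G_1G_1}^{-1}\left(y_1-G_1m_{\cdot}\right)+\tilde K^{(1)}_{sG_2}\left(\tilde K^{(1)}_{G_2G_2}\right)^{-1}\left(y_2-G_2\tilde m^{(1)}_{\cdot}\right),$$ $$\tilde k(s_1,s_2)=k(s_1,s_2)-K_{s_1G_1}K_{G_1G_1}^{-1}K_{s_2G_1}^T-\tilde K^{(1)}_{s_1G_2}\left(\tilde K^{(1)}_{G_2G_2}\right)^{-1}\left(\tilde K^{(1)}_{s_2G_2}\right)^T,$$ where $\tilde m^{(1)}$ denotes the conditional mean function of $Z$ given $G_1Z=y_1$.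
   Context: $C(D)$ is the Banach space of real continuous functions on $D$ with the sup norm; Radon measures are finite signed. The mean and covariance functions are $m_s=\mathbb{E}[Z_s]$, $k(s,t)=\mathbb{E}[Z_sZ_t]-\mathbb{E}[Z_s]\mathbb{E}[Z_t]$. $Gm_\cdot$ is $G$ applied to the mean function. For a bounded linear operator $H=(H_1,\dots,H_p):C(D)\to\mathbb{R}^p$, set $K_{sH}:=(H_ik(\cdot,s))_{i=1,\dots,p}$ (a row vector) and $K_{HH}:=(H_i(H_jk(\cdot,\cdot)))_{i,j=1,\dots,p}$, where $H_j$ acts on one argument of $k$ and $H_i$ on the remaining one. When $K_{HH}$ is invertible, the conditional law of $Z$ given $HZ=y$ is Gaussian with mean function $m_s+K_{sH}K_{HH}^{-1}(y-Hm_\cdot)$ and covariance function $k(s_1,s_2)-K_{s_1H}K_{HH}^{-1}K_{s_2H}^T$ (this is the disintegration with respect to $H$ of the Gaussian measure induced by $Z$ on $C(D)$). In particular, $\tilde m^{(1)}_s=m_s+K_{sG_1}K_{G_1G_1}^{-1}(y_1-G_1m_\cdot)$ and the conditional covariance of $Z$ given $G_1Z$ is $\tilde k^{(1)}(s_1,s_2)=k(s_1,s_2)-K_{s_1G_1}K_{G_1G_1}^{-1}K_{s_2G_1}^T$. The matrices $\tilde K^{(1)}_{sG_2}$ and $\tilde K^{(1)}_{G_2G_2}$ are defined as $K_{sG_2}$ and $K_{G_2G_2}$ with the prior covariance $k$ replaced by $\tilde k^{(1)}$. The functions $\tilde m_s(y)$ and $\tilde k$ are the conditional mean and covariance functions of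 $Z$ given $GZ=y$ for $G=(G_1,G_2):C(D)\to\mathbb{R}^{p_1+p_2}$. *)

theory Defs
  imports "HOL-Probability.Probability"
begin

section \<open>Gaussian processes\<close>

text \<open>Degenerate (almost surely constant) variables count as Gaussian, as is needed for a process
  whose covariance function is only positive semidefinite.\<close>

definition gaussian_rv :: "'w measure \<Rightarrow> ('w \<Rightarrow> real) \<Rightarrow> bool" where
  "gaussian_rv M X \<longleftrightarrow> X \<in> borel_measurable M \<and>
     ((\<exists>\<mu> \<sigma>. 0 < \<sigma> \<and> distributed M lborel X (\<lambda>x. ennreal (normal_density \<mu> \<sigma> x))) \<or>
      (\<exists>c. AE \<omega> in M. X \<omega> = c))"

definition gaussian_process :: "'w measure \<Rightarrow> ('d \<Rightarrow> 'w \<Rightarrow> real) \<Rightarrow> bool" where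
  "gaussian_process M Z \<longleftrightarrow> prob_space M \<and>
     (\<forall>S a. finite S \<longrightarrow> gaussian_rv M (\<lambda>\<omega>. \<Sum>s\<in>S. a s * Z s \<omega>))"

definition mean_fun :: "'w measure \<Rightarrow> ('d \<Rightarrow> 'w \<Rightarrow> real) \<Rightarrow> 'd \<Rightarrow> real" where
  "mean_fun M Z s = (\<integral>\<omega>. Z s \<omega> \<partial>M)"

definition cov_fun :: "'w measure \<Rightarrow> ('d \<Rightarrow> 'w \<Rightarrow> real) \<Rightarrow> 'd \<Rightarrow> 'd \<Rightarrow> real" where
  "cov_fun M Z s t = (\<integral>\<omega>. Z s \<omega> * Z t \<omega> \<partial>M) - (\<integral>\<omega>. Z s \<omega> \<partial>M) * (\<integral>\<omega>. Z t \<omega> \<partial>M)"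

text \<open>For a compact index space \<^typ>\<open>'d\<close>, the type \<^typ>\<open>'d \<Rightarrow>\<^sub>C real\<close> of bounded continuous functions
  is the Banach space C(D). The law of a process with continuous trajectories is the distribution
  of its trajectory, a measure on the Borel sets of C(D).\<close>

definition process_law ::
    "'w measure \<Rightarrow> ('d::metric_space \<Rightarrow> 'w \<Rightarrow> real) \<Rightarrow> ('d \<Rightarrow>\<^sub>C real) measure" where
  "process_law M Z = distr M borel (\<lambda>\<omega>. Bcontfun (\<lambda>s. Z s \<omega>))"

section \<open>Observation operators\<close>

text \<open>A finite signed Radon measure is given by a pair \<open>(\<mu>, \<nu>)\<close> of finite positive Borel measures
  and stands for \<open>\<mu> - \<nu>\<close>; by the Jordan decomposition every finite signed Borel measure is of this
  form. The two measures need not be mutually singular. On a compact metric space every finite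
  Borel measure is regular, so no separate regularity condition is imposed.\<close>

definition signed_radon_measure :: "'d::metric_space measure \<times> 'd measure \<Rightarrow> bool" where
  "signed_radon_measure l \<longleftrightarrow>
     sets (fst l) = sets borel \<and> finite_measure (fst l) \<and>
     sets (snd l) = sets borel \<and> finite_measure (snd l)"

definition signed_integral :: "'d measure \<times> 'd measure \<Rightarrow> ('d \<Rightarrow> real) \<Rightarrow> real" where
  "signed_integral l f = (\<integral>s. f s \<partial>fst l) - (\<integral>s. f s \<partial>snd l)"

definition integral_operator ::
    "('p::finite \<Rightarrow> 'd::metric_space measure \<times> 'd measure) \<Rightarrow> ('d \<Rightarrow>\<^sub>C real) \<Rightarrow> real ^ 'p" where
  "integral_operator l f = (\<chi> i. signed_integral (l i) (apply_bcontfun f))"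

definition join_vec :: "real ^ 'p \<Rightarrow> real ^ 'q \<Rightarrow> real ^ ('p + 'q)" where
  "join_vec u v = (\<chi> i. case i of Inl a \<Rightarrow> u $ a | Inr b \<Rightarrow> v $ b)"

text \<open>An operator \<open>H\<close> acts on \<^typ>\<open>'d \<Rightarrow>\<^sub>C real\<close>, hence the coercions \<^const>\<open>Bcontfun\<close> below. They are
  meaningful because the functions concerned are continuous on a compact space.\<close>

definition cov_vec :: "('d::metric_space \<Rightarrow> 'd \<Rightarrow> real) \<Rightarrow> (('d \<Rightarrow>\<^sub>C real) \<Rightarrow> real ^ 'p) \<Rightarrow>
    'd \<Rightarrow> real ^ 'p" where
  "cov_vec k H s = (\<chi> i. H (Bcontfun (\<lambda>t. k t s)) $ i)"

definition cov_mat :: "('d::metric_space \<Rightarrow> 'd \<Rightarrow> real) \<Rightarrow> (('d \<Rightarrow>\<^sub>C real) \<Rightarrow> real ^ 'p) \<Rightarrow>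
    real ^ 'p ^ 'p" where
  "cov_mat k H = (\<chi> i j. H (Bcontfun (\<lambda>t. H (Bcontfun (\<lambda>s. k s t)) $ j)) $ i)"

section \<open>Conditional laws\<close>

text \<open>\<open>\<kappa>\<close> is a disintegration of \<open>\<mu>\<close> with respect to \<open>T\<close>: a measurable family of probability
  measures, the member \<open>\<kappa> y\<close> being carried by the fibre of \<open>T\<close> over \<open>y\<close> for almost every \<open>y\<close>, whose
  mixture over the image measure of \<open>T\<close> is \<open>\<mu>\<close>.\<close>

definition disintegration :: "'a::topological_space measure \<Rightarrow> ('a \<Rightarrow> 'b::topological_space) \<Rightarrow>
    ('b \<Rightarrow> 'a measure) \<Rightarrow> bool" where
  "disintegration \<mu> T \<kappa> \<longleftrightarrow>
     \<kappa> \<in> borel \<rightarrow>\<^sub>M prob_algebra borel \<and>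
     (AE y in distr \<mu> borel T. emeasure (\<kappa> y) (T -` {y}) = 1) \<and>
     (\<forall>A\<in>sets borel. emeasure \<mu> A = (\<integral>\<^sup>+ y. emeasure (\<kappa> y) A \<partial>distr \<mu> borel T))"

text \<open>A disintegration is unique only up to a null set of values \<open>y\<close>. For a statement about every
  \<open>y\<close> we take the version that depends weakly continuously on \<open>y\<close>. There is at most one such version
  if the law of the observation has full support, in particular if it is a nondegenerate Gaussian
  law.\<close>

definition is_cond_law :: "'w measure \<Rightarrow> ('d::metric_space \<Rightarrow> 'w \<Rightarrow> real) \<Rightarrow>
    (('d \<Rightarrow>\<^sub>C real) \<Rightarrow> real ^ 'p) \<Rightarrow> (real ^ 'p \<Rightarrow> ('d \<Rightarrow>\<^sub>C real) measure) \<Rightarrow> bool" where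
  "is_cond_law M Z H \<kappa> \<longleftrightarrow>
     disintegration (process_law M Z) H \<kappa> \<and>
     (\<forall>f::('d \<Rightarrow>\<^sub>C real) \<Rightarrow> real. continuous_on UNIV f \<and> bounded (range f) \<longrightarrow>
        continuous_on UNIV (\<lambda>y. \<integral>z. f z \<partial>\<kappa> y))"

definition cond_law :: "'w measure \<Rightarrow> ('d::metric_space \<Rightarrow> 'w \<Rightarrow> real) \<Rightarrow>
    (('d \<Rightarrow>\<^sub>C real) \<Rightarrow> real ^ 'p) \<Rightarrow> real ^ 'p \<Rightarrow> ('d \<Rightarrow>\<^sub>C real) measure" where
  "cond_law M Z H = (SOME \<kappa>. is_cond_law M Z H \<kappa>)"

text \<open>Mean and covariance functions of the coordinate process under the conditional law.\<close>

definition cond_mean :: "'w measure \<Rightarrow> ('d::metric_space \<Rightarrow> 'w \<Rightarrow> real) \<Rightarrow>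
    (('d \<Rightarrow>\<^sub>C real) \<Rightarrow> real ^ 'p) \<Rightarrow> real ^ 'p \<Rightarrow> 'd \<Rightarrow> real" where
  "cond_mean M Z H y = mean_fun (cond_law M Z H y) (\<lambda>s z. apply_bcontfun z s)"

definition cond_cov :: "'w measure \<Rightarrow> ('d::metric_space \<Rightarrow> 'w \<Rightarrow> real) \<Rightarrow>
    (('d \<Rightarrow>\<^sub>C real) \<Rightarrow> real ^ 'p) \<Rightarrow> real ^ 'p \<Rightarrow> 'd \<Rightarrow> 'd \<Rightarrow> real" where
  "cond_cov M Z H y = cov_fun (cond_law M Z H y) (\<lambda>s z. apply_bcontfun z s)"

end

theory Submission
  imports Defs
begin

text \<open>Everything happens under one Borel probability measure, the law \<open>\<mu>\<close> of the trajectory of \<open>Z\<close> on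
\<open>C(D)\<close>. Conditioning on an observation \<open>H\<close> with values in a finite-dimensional space amounts to
finding a bounded linear \<open>\<Phi>\<close> with \<open>H \<circ> \<Phi> = id\<close> such that the residual \<open>z - \<Phi> (H z)\<close> is uncorrelated
with \<open>H\<close>. Under a Gaussian measure uncorrelated means independent, so replacing the recoverable
part \<open>\<Phi> (H z)\<close> by \<open>\<Phi> y\<close> gives a disintegration whose member at \<open>y\<close> is the law of
\<open>z - \<Phi> (H z) + \<Phi> y\<close> (\<open>residual_disintegration\<close>). It depends weakly continuously on \<open>y\<close>, and since the
law of a nondegenerate observation has full support, no other version does; hence it is the
conditional law for every \<open>y\<close> (\<open>continuous_disintegration_unique\<close>, \<open>observation_full_support\<close>).

For a single stage, \<open>\<Phi>\<close> is regression on the observations, that is \<open>K_{sH} K_{HH}^{-1}\<close>. For the pair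
\<open>(G1, G2)\<close> the block inverse is never formed. The law conditioned on the first stage is again
Gaussian and its regression operator \<open>\<Phi>2\<close> for \<open>G2\<close> has values in the kernel of \<open>G1\<close>, because the
first observation has no variance left. So the composition of the two residual maps is itself a
residual map for \<open>(G1, G2)\<close>, with \<open>\<Phi> (y1, y2) = \<Phi>1 y1 + \<Phi>2 (y2 - G2 (\<Phi>1 y1))\<close>. Reading off mean and
covariance of its image law gives the two update formulas (\<open>joint_mean\<close>, \<open>joint_cov\<close>).

Two analytic facts carry the rest. Pointwise limits of Gaussian variables are Gaussian with
convergent means and variances; together with a partition-of-unity interpolation in \<open>C(D)\<close> this makes
every bounded functional of the trajectory Gaussian and lets functionals act on the mean and
covariance functions. And finite measures are determined by the characteristic functions of a
linear family of functions, on the \<open>\<sigma>\<close>-algebra generated by that family; this yields independence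
from vanishing covariance and the uniqueness of conditional laws.\<close>

section \<open>Gaussian random variables and their pointwise limits\<close>

lemma char_distr_eq:
  assumes "X \<in> borel_measurable M"
  shows "char (distr M borel X) t = (CLINT \<omega>|M. iexp (t * X \<omega>))"
  unfolding char_def using assms by (subst integral_distr) auto

lemma normal_rv_moments:
  assumes "prob_space M" "0 < \<sigma>"
    and X: "distributed M lborel X (\<lambda>x. ennreal (normal_density \<mu> \<sigma> x))"
  shows "integrable M X" "integrable M (\<lambda>\<omega>. (X \<omega>)\<^sup>2)"
    and "(\<integral>\<omega>. X \<omega> \<partial>M) = \<mu>" "(\<integral>\<omega>. (X \<omega>)\<^sup>2 \<partial>M) - (\<integral>\<omega>. X \<omega> \<partial>M)\<^sup>2 = \<sigma>\<^sup>2"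
    and "(CLINT \<omega>|M. iexp (t * X \<omega>)) = exp (\<i> * of_real (t * \<mu>) - of_real (t\<^sup>2 * \<sigma>\<^sup>2 / 2))"
proof -
  interpret prob_space M by fact
  let ?N = "\<lambda>\<omega>. (X \<omega> - \<mu>) / \<sigma>"
  have N: "distributed M lborel ?N (\<lambda>x. ennreal (std_normal_density x))"
    using X normal_standard_normal_convert[OF \<open>0 < \<sigma>\<close>] by blast
  have N_meas [measurable]: "?N \<in> borel_measurable M"
    using distributed_measurable[OF N] by simp
  have X_eq: "X \<omega> = \<mu> + \<sigma> * ?N \<omega>" for \<omega> using \<open>0 < \<sigma>\<close> by simp
  have int: "integrable M (\<lambda>\<omega>. ?N \<omega> ^ j)" for j
    using distributed_integrable[OF N, of "\<lambda>x. x ^ j"] integrable_std_normal_moment[of j]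
    by simp
  have intX: "integrable M (\<lambda>\<omega>. \<mu> + \<sigma> * ?N \<omega>)"
    using int[of 1] by (intro Bochner_Integration.integrable_add integrable_mult_right integrable_const) (simp only: power_one_right)
  then show 1: "integrable M X" by (subst (asm) X_eq[symmetric])
  have "integrable M (\<lambda>\<omega>. \<mu>\<^sup>2 + 2 * \<mu> * \<sigma> * (?N \<omega>)^1 + \<sigma>\<^sup>2 * (?N \<omega>)\<^sup>2)"
    by (intro Bochner_Integration.integrable_add integrable_mult_right int) auto
  also have "(\<lambda>\<omega>. \<mu>\<^sup>2 + 2 * \<mu> * \<sigma> * (?N \<omega>)^1 + \<sigma>\<^sup>2 * (?N \<omega>)\<^sup>2) = (\<lambda>\<omega>. (X \<omega>)\<^sup>2)"
    by (subst (3) X_eq, rule ext) (simp add: power2_eq_square algebra_simps)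
  finally show 2: "integrable M (\<lambda>\<omega>. (X \<omega>)\<^sup>2)" .
  show E: "(\<integral>\<omega>. X \<omega> \<partial>M) = \<mu>"
    using normal_distributed_expectation[OF \<open>0 < \<sigma>\<close> X] .
  show "(\<integral>\<omega>. (X \<omega>)\<^sup>2 \<partial>M) - (\<integral>\<omega>. X \<omega> \<partial>M)\<^sup>2 = \<sigma>\<^sup>2"
    using normal_distributed_variance[OF \<open>0 < \<sigma>\<close> X] variance_eq[OF 1 2] by simp
  have "(CLINT \<omega>|M. iexp (t * X \<omega>)) = (CLINT \<omega>|M. iexp (t * \<mu>) * iexp (t * \<sigma> * ?N \<omega>))"
    by (subst X_eq) (simp add: exp_add[symmetric] algebra_simps)
  also have "\<dots> = iexp (t * \<mu>) * (CLINT \<omega>|M. iexp (t * \<sigma> * ?N \<omega>))"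
    by (rule integral_mult_right_zero)
  also have "(CLINT \<omega>|M. iexp (t * \<sigma> * ?N \<omega>)) = char (distr M borel ?N) (t * \<sigma>)"
    by (rule char_distr_eq[symmetric]) simp
  also have "distr M borel ?N = std_normal_distribution"
    using distributed_distr_eq_density[OF N] by (simp cong: distr_cong)
  also have "char std_normal_distribution (t * \<sigma>) = of_real (exp (- (t * \<sigma>)\<^sup>2 / 2))"
    by (simp add: char_std_normal_distribution)
  also have "iexp (t * \<mu>) * of_real (exp (- (t * \<sigma>)\<^sup>2 / 2)) = exp (\<i> * of_real (t * \<mu>) - of_real (t\<^sup>2 * \<sigma>\<^sup>2 / 2))"
    unfolding exp_of_real[symmetric] mult_exp_exp by (simp add: power_mult_distrib)
  finally show "(CLINT \<omega>|M. iexp (t * X \<omega>)) = exp (\<i> * of_real (t * \<mu>) - of_real (t\<^sup>2 * \<sigma>\<^sup>2 / 2))" .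
qed

context prob_space begin

lemma integral_AE_const:
  fixes g :: "real \<Rightarrow> 'b::{banach, second_countable_topology}"
  assumes [measurable]: "X \<in> borel_measurable M" and c: "AE \<omega> in M. X \<omega> = c"
    and [measurable]: "g \<in> borel_measurable borel"
  shows "(\<integral>\<omega>. g (X \<omega>) \<partial>M) = g c"
proof -
  have "(\<integral>\<omega>. g (X \<omega>) \<partial>M) = (\<integral>\<omega>. g c \<partial>M)"
    using c by (intro integral_cong_AE) auto
  then show ?thesis by (simp add: prob_space)
qed

definition var :: "('a \<Rightarrow> real) \<Rightarrow> real" where
  "var X = expectation (\<lambda>\<omega>. (X \<omega>)\<^sup>2) - (expectation X)\<^sup>2"

lemma
  assumes "gaussian_rv M X"
  shows gaussian_rv_measurable [measurable_dest]: "X \<in> borel_measurable M"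
    and gaussian_rv_integrable: "integrable M X"
    and gaussian_rv_integrable_square: "integrable M (\<lambda>\<omega>. (X \<omega>)\<^sup>2)"
    and gaussian_rv_var_nonneg: "0 \<le> var X"
    and gaussian_rv_cf: "(CLINT \<omega>|M. iexp (t * X \<omega>)) =
           exp (\<i> * of_real (t * expectation X) - of_real (t\<^sup>2 * var X / 2))"
proof -
  show meas: "X \<in> borel_measurable M" using assms by (simp add: gaussian_rv_def)
  have "integrable M X \<and> integrable M (\<lambda>\<omega>. (X \<omega>)\<^sup>2) \<and> 0 \<le> var X \<and> (CLINT \<omega>|M. iexp (t * X \<omega>)) =
           exp (\<i> * of_real (t * expectation X) - of_real (t\<^sup>2 * var X / 2))"
    using assms unfolding gaussian_rv_def
  proof (elim conjE disjE exE)
    fix \<mu> \<sigma> assume \<sigma>: "0 < \<sigma>" and d: "distributed M lborel X (\<lambda>x. ennreal (normal_density \<mu> \<sigma> x))"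
    note * = normal_rv_moments[OF prob_space_axioms \<sigma> d]
    have "var X = \<sigma>\<^sup>2" unfolding var_def by (rule *)
    with *(1,2,3,5) show ?thesis by auto
  next
    fix c assume c: "AE \<omega> in M. X \<omega> = c"
    have i: "integrable M X" "integrable M (\<lambda>\<omega>. (X \<omega>)\<^sup>2)"
      using c meas
      by (auto intro: integrable_const_bound[of X "\<bar>c\<bar>"] integrable_const_bound[of "\<lambda>\<omega>. (X \<omega>)\<^sup>2" "c\<^sup>2"] elim: eventually_mono)
    have "expectation X = expectation (\<lambda>_. c)" "expectation (\<lambda>\<omega>. (X \<omega>)\<^sup>2) = expectation (\<lambda>_. c\<^sup>2)"
      "(CLINT \<omega>|M. iexp (t * X \<omega>)) = (CLINT \<omega>|M. iexp (t * c))"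
      using integral_AE_const[OF meas c, of "\<lambda>x. x"] integral_AE_const[OF meas c, of "\<lambda>x. x\<^sup>2"]
        integral_AE_const[OF meas c, of "\<lambda>x. iexp (t * x)"] by (simp_all add: prob_space)
    with i show ?thesis by (simp add: prob_space var_def)
  qed
  then show "integrable M X" "integrable M (\<lambda>\<omega>. (X \<omega>)\<^sup>2)" "0 \<le> var X"
    "(CLINT \<omega>|M. iexp (t * X \<omega>)) = exp (\<i> * of_real (t * expectation X) - of_real (t\<^sup>2 * var X / 2))"
    by auto
qed

text \<open>By one-dimensional Levy uniqueness the characteristic function identifies the law; a vanishing
variance parameter corresponds to a Dirac law, the degenerate alternative of \<^const>\<open>gaussian_rv\<close>.\<close>

lemma gaussian_rvI_cf:
  assumes meas [measurable]: "X \<in> borel_measurable M" and "0 \<le> v"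
    and cf: "\<And>t. (CLINT \<omega>|M. iexp (t * X \<omega>)) = exp (\<i> * of_real (t * \<mu>) - of_real (t\<^sup>2 * v / 2))"
  shows "gaussian_rv M X" "expectation X = \<mu>" "var X = v"
proof -
  have rd: "real_distribution (distr M borel X)"
    by (rule real_distribution_distr) simp
  have "gaussian_rv M X \<and> expectation X = \<mu> \<and> var X = v"
  proof (cases "v = 0")
    case True
    interpret R: prob_space "return borel \<mu> :: real measure"
      by (rule prob_space_return) simp
    have rd': "real_distribution (return borel \<mu>)"
      by unfold_locales auto
    have "char (distr M borel X) = char (return borel \<mu>)"
    proof
      fix t
      have "char (return borel \<mu>) t = iexp (t * \<mu>)"
        unfolding char_def by (subst integral_return) auto
      then show "char (distr M borel X) t = char (return borel \<mu>) t"
        using True cf[of t] by (simp add: char_distr_eq)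
    qed
    from Levy_uniqueness[OF rd rd' this] have eq: "distr M borel X = return borel \<mu>" .
    have "AE x in distr M borel X. x = \<mu>" unfolding eq by (subst AE_return) auto
    then have ae: "AE \<omega> in M. X \<omega> = \<mu>" by (subst (asm) AE_distr_iff) auto
    have "expectation X = expectation (\<lambda>_. \<mu>)" "expectation (\<lambda>\<omega>. (X \<omega>)\<^sup>2) = expectation (\<lambda>_. \<mu>\<^sup>2)"
      using integral_AE_const[OF meas ae, of "\<lambda>x. x"] integral_AE_const[OF meas ae, of "\<lambda>x. x\<^sup>2"]
      by (simp_all add: prob_space)
    with True ae show ?thesis by (auto simp: gaussian_rv_def prob_space var_def)
  next
    case False
    define \<sigma> where "\<sigma> = sqrt v"
    have \<sigma>: "0 < \<sigma>" "\<sigma>\<^sup>2 = v" using False \<open>0 \<le> v\<close> by (auto simp: \<sigma>_def)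
    let ?D = "density lborel (\<lambda>x. ennreal (normal_density \<mu> \<sigma> x))"
    interpret D: prob_space ?D by (rule prob_space_normal_density[OF \<sigma>(1)])
    have rd': "real_distribution ?D" by unfold_locales auto
    have dD: "distributed ?D lborel (\<lambda>x. x) (\<lambda>x. ennreal (normal_density \<mu> \<sigma> x))"
      by (auto simp: distributed_def distr_id2)
    have "char (distr M borel X) = char ?D"
    proof
      fix t
      have "char ?D t = exp (\<i> * of_real (t * \<mu>) - of_real (t\<^sup>2 * \<sigma>\<^sup>2 / 2))"
        unfolding char_def
        using normal_rv_moments(5)[OF D.prob_space_axioms \<sigma>(1) dD, of t] by simp
      then show "char (distr M borel X) t = char ?D t"
        using cf[of t] \<sigma> by (simp add: char_distr_eq)
    qed
    from Levy_uniqueness[OF rd rd' this] have eq: "distr M borel X = ?D" .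
    have "distr M lborel X = distr M borel X" by (simp cong: distr_cong)
    with eq have d: "distributed M lborel X (\<lambda>x. ennreal (normal_density \<mu> \<sigma> x))"
      by (auto simp: distributed_def)
    with \<sigma> normal_rv_moments(3,4)[OF prob_space_axioms \<sigma>(1) d] show ?thesis
      by (auto simp: gaussian_rv_def var_def)
  qed
  then show "gaussian_rv M X" "expectation X = \<mu>" "var X = v" by auto
qed

text \<open>The characteristic functions of the \<open>X n\<close> converge to that of the limit. Their moduli involve the
variances only, so the variances converge. What remains are the pure oscillations
\<open>exp (i t \<mu>\<^sub>n)\<close>, and the identity \<open>i \<mu>\<^sub>n \<integral>\<^sub>0\<^sup>b exp (i t \<mu>\<^sub>n) dt = exp (i b \<mu>\<^sub>n) - 1\<close> recovers the means as
soon as \<open>b\<close> is so small that the limit of the integrals does not vanish.\<close>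

lemma
  assumes g: "\<And>n. gaussian_rv M (X n)"
    and lim: "\<And>\<omega>. \<omega> \<in> space M \<Longrightarrow> (\<lambda>n. X n \<omega>) \<longlonglongrightarrow> Y \<omega>"
  shows gaussian_rv_LIMSEQ: "gaussian_rv M Y"
    and expectation_gaussian_LIMSEQ: "(\<lambda>n. expectation (X n)) \<longlonglongrightarrow> expectation Y"
    and var_gaussian_LIMSEQ: "(\<lambda>n. var (X n)) \<longlonglongrightarrow> var Y"
proof -
  have X_meas [measurable]: "X n \<in> borel_measurable M" for n
    using g by (rule gaussian_rv_measurable)
  have Y_meas [measurable]: "Y \<in> borel_measurable M"
    by (rule borel_measurable_LIMSEQ_real[OF lim X_meas])
  define \<phi> where "\<phi> t = (CLINT \<omega>|M. iexp (t * Y \<omega>))" for t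
  have \<phi>_lim: "(\<lambda>n. CLINT \<omega>|M. iexp (t * X n \<omega>)) \<longlonglongrightarrow> \<phi> t" for t
    unfolding \<phi>_def
    by (rule integral_dominated_convergence[where w = "\<lambda>_. 1"])
      (auto intro!: tendsto_intros lim)
  have \<phi>_char: "\<phi> = char (distr M borel Y)"
    by (simp add: \<phi>_def char_distr_eq fun_eq_iff)
  interpret D: real_distribution "distr M borel Y"
    by (rule real_distribution_distr) simp
  have \<phi>_cont: "isCont \<phi> t" for t
    unfolding \<phi>_char by (rule D.isCont_char)
  have \<phi>_0: "\<phi> 0 = 1" unfolding \<phi>_char by (rule D.char_zero)
  have near: "\<exists>a>0. \<forall>t. \<bar>t\<bar> \<le> a \<longrightarrow> cmod (f t - 1) < 1 / 2" if "isCont f 0" "f 0 = 1" for f :: "real \<Rightarrow> complex"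
  proof -
    from that obtain d where d: "d > 0" "\<And>t. \<bar>t\<bar> < d \<Longrightarrow> cmod (f t - 1) < 1 / 2"
      unfolding continuous_at_eps_delta dist_norm by (metis diff_zero half_gt_zero_iff real_norm_def zero_less_one)
    then show ?thesis by (intro exI[of _ "d / 2"]) auto
  qed
  \<comment> \<open>At such an \<open>a\<close> the limiting characteristic function does not vanish, so logarithms of moduli converge.\<close>
  from near[OF \<phi>_cont \<phi>_0] obtain a where a: "a > 0" "cmod (\<phi> a - 1) < 1 / 2" by force
  have "\<phi> a \<noteq> 0" using a(2) by auto
  have "(\<lambda>n. cmod (CLINT \<omega>|M. iexp (a * X n \<omega>))) \<longlonglongrightarrow> cmod (\<phi> a)"
    by (intro tendsto_norm \<phi>_lim)
  then have "(\<lambda>n. exp (- (a\<^sup>2 * var (X n) / 2))) \<longlonglongrightarrow> cmod (\<phi> a)"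
    unfolding gaussian_rv_cf[OF g] norm_exp_eq_Re by simp
  then have "(\<lambda>n. ln (exp (- (a\<^sup>2 * var (X n) / 2)))) \<longlonglongrightarrow> ln (cmod (\<phi> a))"
    by (rule tendsto_ln) (use \<open>\<phi> a \<noteq> 0\<close> in simp)
  then have "(\<lambda>n. - (2 / a\<^sup>2) * ln (exp (- (a\<^sup>2 * var (X n) / 2)))) \<longlonglongrightarrow> - (2 / a\<^sup>2) * ln (cmod (\<phi> a))"
    by (rule tendsto_mult_left)
  moreover define v where "v = - (2 / a\<^sup>2) * ln (cmod (\<phi> a))"
  ultimately have v_lim: "(\<lambda>n. var (X n)) \<longlonglongrightarrow> v" using \<open>a > 0\<close> by simp
  have "0 \<le> v" by (rule LIMSEQ_le_const[OF v_lim]) (auto intro: gaussian_rv_var_nonneg g)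
  \<comment> \<open>The limit of the pure oscillations, with the Gaussian damping divided out.\<close>
  define \<psi> where "\<psi> t = \<phi> t * of_real (exp (t\<^sup>2 * v / 2))" for t
  have \<psi>_lim: "(\<lambda>n. iexp (t * expectation (X n))) \<longlonglongrightarrow> \<psi> t" for t
  proof -
    have "iexp (t * expectation (X n)) =
        (CLINT \<omega>|M. iexp (t * X n \<omega>)) * of_real (exp (t\<^sup>2 * var (X n) / 2))" for n
      unfolding gaussian_rv_cf[OF g] exp_of_real[symmetric] mult_exp_exp by simp
    then show ?thesis unfolding \<psi>_def
      by (simp only:) (intro tendsto_intros \<phi>_lim v_lim; simp)
  qed
  have \<psi>_cont: "isCont \<psi> t" for t
    unfolding \<psi>_def by (intro continuous_intros \<phi>_cont) auto
  have "\<psi> 0 = 1" by (simp add: \<psi>_def \<phi>_0)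
  from near[OF \<psi>_cont this] obtain b where b: "b > 0" "\<And>t. \<bar>t\<bar> \<le> b \<Longrightarrow> cmod (\<psi> t - 1) < 1 / 2" by auto
  define I where "I \<mu> = integral {0..b} (\<lambda>t. iexp (t * \<mu>))" for \<mu> :: real
  have I_eq: "\<i> * of_real \<mu> * I \<mu> = iexp (b * \<mu>) - 1" for \<mu>
  proof -
    have "((\<lambda>t. \<i> * of_real \<mu> * iexp (t * \<mu>)) has_integral iexp (b * \<mu>) - iexp (0 * \<mu>)) {0..b}"
      using b(1) by (intro fundamental_theorem_of_calculus)
        (auto intro!: derivative_eq_intros has_vector_derivative_real_field simp: algebra_simps)
    then have "integral {0..b} (\<lambda>t. \<i> * of_real \<mu> * iexp (t * \<mu>)) = iexp (b * \<mu>) - iexp (0 * \<mu>)"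
      by (rule integral_unique)
    then show ?thesis unfolding I_def Henstock_Kurzweil_Integration.integral_mult_right by simp
  qed
  have \<psi>_int: "\<psi> integrable_on {0..b}"
    by (intro integrable_continuous_interval continuous_at_imp_continuous_on ballI \<psi>_cont)
  have I_lim: "(\<lambda>n. I (expectation (X n))) \<longlonglongrightarrow> integral {0..b} \<psi>"
    unfolding I_def
    by (rule dominated_convergence(2)[where h = "\<lambda>_. 1", OF _ _ _ \<psi>_lim])
      (auto intro!: integrable_continuous_interval continuous_intros)
  have "norm (integral {0..b} (\<lambda>t. \<psi> t - 1)) \<le> integral {0..b} (\<lambda>_. 1 / 2)"
    using b by (intro integral_norm_bound_integral integrable_diff \<psi>_int) (auto intro: less_imp_le)
  then have "cmod (integral {0..b} \<psi> - b) \<le> b / 2"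
    using b(1) Henstock_Kurzweil_Integration.integral_diff[OF \<psi>_int integrable_const_ivl[of "1 :: complex" 0 b]]
    by (simp add: scaleR_conv_of_real)
  then have I_nz: "integral {0..b} \<psi> \<noteq> 0" using b(1) by auto
  have "(\<lambda>n. (iexp (b * expectation (X n)) - 1) / (\<i> * I (expectation (X n)))) \<longlonglongrightarrow>
      (\<psi> b - 1) / (\<i> * integral {0..b} \<psi>)"
    using I_nz by (intro tendsto_intros \<psi>_lim I_lim) auto
  then have "(\<lambda>n. complex_of_real (expectation (X n))) \<longlonglongrightarrow> (\<psi> b - 1) / (\<i> * integral {0..b} \<psi>)"
    by (rule Lim_transform_eventually)
      (use tendsto_imp_eventually_ne[OF I_lim I_nz] in eventually_elim,
        simp only: I_eq[symmetric], simp)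
  from tendsto_Re[OF this] obtain \<mu> where \<mu>_lim: "(\<lambda>n. expectation (X n)) \<longlonglongrightarrow> \<mu>"
    unfolding Re_complex_of_real by blast
  have "\<phi> t = exp (\<i> * of_real (t * \<mu>) - of_real (t\<^sup>2 * v / 2))" for t
  proof (rule LIMSEQ_unique[OF \<phi>_lim])
    show "(\<lambda>n. CLINT \<omega>|M. iexp (t * X n \<omega>)) \<longlonglongrightarrow> exp (\<i> * of_real (t * \<mu>) - of_real (t\<^sup>2 * v / 2))"
      unfolding gaussian_rv_cf[OF g] by (intro tendsto_intros \<mu>_lim v_lim) auto
  qed
  note * = gaussian_rvI_cf[OF Y_meas \<open>0 \<le> v\<close> this[unfolded \<phi>_def]]
  show "gaussian_rv M Y" by (rule *)
  show "(\<lambda>n. expectation (X n)) \<longlonglongrightarrow> expectation Y" "(\<lambda>n. var (X n)) \<longlonglongrightarrow> var Y"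
    using \<mu>_lim v_lim * by auto
qed

end

section \<open>Characteristic functions of linear families of functions\<close>

text \<open>The statements below are about families of real functions rather than vector-valued maps, so that the
coordinate functionals of an infinite-dimensional space are covered without a choice of basis.\<close>

definition linear_family :: "('a \<Rightarrow> real) set \<Rightarrow> bool" where
  "linear_family V \<longleftrightarrow> (\<lambda>_. 0) \<in> V \<and> (\<forall>f\<in>V. \<forall>g\<in>V. (\<lambda>x. f x + g x) \<in> V) \<and> (\<forall>c. \<forall>f\<in>V. (\<lambda>x. c * f x) \<in> V)"

definition events_of :: "'a measure \<Rightarrow> ('a \<Rightarrow> real) set \<Rightarrow> 'a set set" where
  "events_of M V = sigma_sets (space M) {f -` B \<inter> space M | f B. f \<in> V \<and> B \<in> sets borel}"

lemma events_of_subset: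
  assumes "V \<subseteq> borel_measurable M"
  shows "events_of M V \<subseteq> sets M"
  unfolding events_of_def using assms
  by (intro sets.sigma_sets_subset) (auto intro: measurable_sets)

context finite_measure begin

lemma integrable_bounded_iexp:
  fixes w f :: "'a \<Rightarrow> real"
  assumes [measurable]: "w \<in> borel_measurable M" "f \<in> borel_measurable M"
    and "\<And>x. \<bar>w x\<bar> \<le> C"
  shows "integrable M (\<lambda>x. of_real (w x) * iexp (f x))"
  using assms(3) by (intro integrable_const_bound[where B = C]) (auto simp: norm_mult)

lemma integrable_bounded:
  fixes w :: "'a \<Rightarrow> real"
  assumes "w \<in> borel_measurable M" "\<And>x. \<bar>w x\<bar> \<le> C"
  shows "integrable M w"
  using assms by (intro integrable_const_bound[where B = C]) auto

text \<open>The nonnegative weights \<open>1 + cos g\<close> and \<open>1 + sin g\<close> turn oscillating factors into densities: integrals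
against them are combinations of integrals of \<open>iexp (a + g)\<close>, \<open>iexp (a - g)\<close> and \<open>iexp a\<close>.\<close>

lemma
  fixes w a g :: "'a \<Rightarrow> real"
  assumes [measurable]: "w \<in> borel_measurable M" "a \<in> borel_measurable M" "g \<in> borel_measurable M"
    and w: "\<And>x. \<bar>w x\<bar> \<le> C"
  shows integral_cos_weight: "(CLINT x|M. of_real (w x * (1 + cos (g x))) * iexp (a x)) =
      (CLINT x|M. of_real (w x) * iexp (a x))
      + (CLINT x|M. of_real (w x) * iexp (a x + g x)) / 2
      + (CLINT x|M. of_real (w x) * iexp (a x - g x)) / 2" (is ?cos)
    and integral_sin_weight: "(CLINT x|M. of_real (w x * (1 + sin (g x))) * iexp (a x)) =
      (CLINT x|M. of_real (w x) * iexp (a x))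
      + (CLINT x|M. of_real (w x) * iexp (a x + g x)) / (2 * \<i>)
      - (CLINT x|M. of_real (w x) * iexp (a x - g x)) / (2 * \<i>)" (is ?sin)
proof -
  note int = integrable_bounded_iexp[OF _ _ w]
  have cos: "complex_of_real (v * (1 + cos y)) = of_real v * (1 + (iexp y + iexp (- y)) / 2)"
   and sin: "complex_of_real (v * (1 + sin y)) = of_real v * (1 + (iexp y - iexp (- y)) / (2 * \<i>))" for v y
    by (simp_all add: cos_of_real[symmetric] sin_of_real[symmetric] cos_exp_eq sin_exp_eq del: cos_of_real sin_of_real)
  have split: "iexp (x + y) = iexp x * iexp y" "iexp (x - y) = iexp x * iexp (- y)" for x y
    by (simp_all add: mult_exp_exp algebra_simps)
  have "(CLINT x|M. of_real (w x * (1 + cos (g x))) * iexp (a x)) =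
     (CLINT x|M. of_real (w x) * iexp (a x) + of_real (w x) * iexp (a x + g x) / 2 + of_real (w x) * iexp (a x - g x) / 2)"
    by (simp only: cos split) (simp add: algebra_simps add_divide_distrib)
  also have "\<dots> = (CLINT x|M. of_real (w x) * iexp (a x))
      + (CLINT x|M. of_real (w x) * iexp (a x + g x)) / 2
      + (CLINT x|M. of_real (w x) * iexp (a x - g x)) / 2"
    by (simp only: Bochner_Integration.integral_add integral_divide_zero int integrable_divide_zero
        borel_measurable_add borel_measurable_diff Bochner_Integration.integrable_add assms)
  finally show ?cos .
  have "(CLINT x|M. of_real (w x * (1 + sin (g x))) * iexp (a x)) =
     (CLINT x|M. of_real (w x) * iexp (a x) + of_real (w x) * iexp (a x + g x) / (2 * \<i>) - of_real (w x) * iexp (a x - g x) / (2 * \<i>))"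
    by (simp only: sin split)
      (simp add: algebra_simps add_divide_distrib diff_divide_distrib del: divide_const_simps)
  also have "\<dots> = (CLINT x|M. of_real (w x) * iexp (a x))
      + (CLINT x|M. of_real (w x) * iexp (a x + g x)) / (2 * \<i>)
      - (CLINT x|M. of_real (w x) * iexp (a x - g x)) / (2 * \<i>)"
    by (simp only: Bochner_Integration.integral_add Bochner_Integration.integral_diff integral_divide_zero int integrable_divide_zero
        borel_measurable_add borel_measurable_diff Bochner_Integration.integrable_add assms)
  finally show ?sin .
qed

text \<open>The way back from the nonnegative weights: \<open>iexp g = (1 + cos g) + \<i> (1 + sin g) - (1 + \<i>)\<close>.\<close>

lemma integral_iexp_weights:
  fixes w g :: "'a \<Rightarrow> real"
  assumes [measurable]: "w \<in> borel_measurable M" "g \<in> borel_measurable M"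
    and w: "\<And>x. \<bar>w x\<bar> \<le> C"
  shows "(CLINT x|M. of_real (w x) * iexp (g x)) =
      of_real (LINT x|M. w x * (1 + cos (g x))) + \<i> * of_real (LINT x|M. w x * (1 + sin (g x)))
      - (1 + \<i>) * of_real (LINT x|M. w x)"
proof -
  have int_w: "integrable M w" by (rule integrable_bounded[OF _ w]) simp
  have int_c: "integrable M (\<lambda>x. w x * cos (g x))" and int_s: "integrable M (\<lambda>x. w x * sin (g x))"
    using w by (auto intro!: integrable_bounded[where C = C] order_trans[OF mult_mono[OF w abs_cos_le_one]]
        order_trans[OF mult_mono[OF w abs_sin_le_one]] simp: abs_mult order_trans[OF abs_ge_zero w])
  have "(CLINT x|M. of_real (w x) * iexp (g x)) =
     (CLINT x|M. of_real (w x * cos (g x)) + \<i> * of_real (w x * sin (g x)))"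
    by (simp add: exp_Euler cos_of_real sin_of_real algebra_simps)
  also have "\<dots> = of_real (LINT x|M. w x * cos (g x)) + \<i> * of_real (LINT x|M. w x * sin (g x))"
    by (subst Bochner_Integration.integral_add)
      (simp_all only: integral_mult_right_zero integral_complex_of_real int_c int_s integrable_of_real integrable_mult_right)
  finally show ?thesis
    using int_c int_s int_w by (simp add: distrib_left algebra_simps)
qed

lemma weighted_image:
  fixes f u :: "'a \<Rightarrow> real" and h :: "real \<Rightarrow> 'b::{banach, second_countable_topology}"
  assumes [measurable]: "f \<in> borel_measurable M" "u \<in> borel_measurable M" "h \<in> borel_measurable borel"
    and u: "\<And>x. 0 \<le> u x" "\<And>x. u x \<le> C" and c: "(LINT x|M. u x) = c" "0 < c"
  defines "D \<equiv> distr (density M (\<lambda>x. ennreal (u x / c))) borel f"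
  shows "real_distribution D" "(LINT x|D. h x) = (LINT x|M. (u x / c) *\<^sub>R h (f x))"
proof -
  have int: "integrable M u"
    using u by (intro integrable_bounded[where C = C]) auto
  have "emeasure (density M (\<lambda>x. ennreal (u x / c))) (space M) = (\<integral>\<^sup>+x. ennreal (u x / c) \<partial>M)"
    by (subst emeasure_density) (auto intro!: nn_integral_cong)
  also have "\<dots> = ennreal (LINT x|M. u x / c)"
    using u c int by (intro nn_integral_eq_integral) auto
  also have "\<dots> = 1" using c by simp
  finally have "prob_space (density M (\<lambda>x. ennreal (u x / c)))"
    by (intro prob_spaceI) simp
  then interpret P: prob_space "density M (\<lambda>x. ennreal (u x / c))" .
  show "real_distribution D" unfolding D_def
    by (rule P.real_distribution_distr) simp
  show "(LINT x|D. h x) = (LINT x|M. (u x / c) *\<^sub>R h (f x))"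
    unfolding D_def using u c by (subst integral_distr, simp, simp, subst integral_density) auto
qed

end

text \<open>One-dimensional Levy uniqueness, applied to the images under \<open>f\<close> of the normalised measures with
density \<open>u\<close>.\<close>

lemma weighted_Levy_uniqueness:
  fixes f u :: "'a \<Rightarrow> real"
  assumes "finite_measure M" "finite_measure N" and sets: "sets M = sets N"
    and [measurable]: "f \<in> borel_measurable M" "u \<in> borel_measurable M" "B \<in> sets borel"
    and u: "\<And>x. 0 \<le> u x" "\<And>x. u x \<le> C"
    and cf: "\<And>t. (CLINT x|M. of_real (u x) * iexp (t * f x)) = (CLINT x|N. of_real (u x) * iexp (t * f x))"
  shows "(LINT x|M. u x * indicator B (f x)) = (LINT x|N. u x * indicator B (f x))"
proof -
  interpret M: finite_measure M by fact
  interpret N: finite_measure N by fact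
  have meas [measurable]: "f \<in> borel_measurable N" "u \<in> borel_measurable N"
    using sets by (auto cong: measurable_cong_sets)
  define c where "c = (LINT x|M. u x)"
  have "of_real (LINT x|M. u x) = complex_of_real (LINT x|N. u x)" using cf[of 0] by simp
  then have cN: "(LINT x|N. u x) = c" by (simp add: c_def)
  have int: "integrable M u" "integrable N u"
    using u by (auto intro!: M.integrable_bounded[where C = C] N.integrable_bounded[where C = C])
  show ?thesis
  proof (cases "c = 0")
    case True
    have "AE x in M. u x = 0" "AE x in N. u x = 0"
      using True cN c_def u integral_nonneg_eq_0_iff_AE[OF int(1)] integral_nonneg_eq_0_iff_AE[OF int(2)] by auto
    then have "(LINT x|M. u x * indicator B (f x)) = (LINT x|M. 0)"
      "(LINT x|N. u x * indicator B (f x)) = (LINT x|N. 0)"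
      by (intro integral_cong_AE; auto)+
    then show ?thesis by simp
  next
    case False
    moreover have "0 \<le> c" unfolding c_def using u by (intro integral_nonneg_AE) auto
    ultimately have "0 < c" by simp
    let ?D = "\<lambda>K. distr (density K (\<lambda>x. ennreal (u x / c))) borel f"
    note M = M.weighted_image[where f = f and u = u and C = C and c = c, OF _ _ _ u c_def[symmetric] \<open>0 < c\<close>, simplified]
    note N = N.weighted_image[where f = f and u = u and C = C and c = c, OF _ _ _ u cN \<open>0 < c\<close>, simplified]
    have eq: "?D M = ?D N"
    proof (rule Levy_uniqueness)
      show "real_distribution (?D M)" by (rule M(1)[of "\<lambda>x. x"]) auto
      show "real_distribution (?D N)" by (rule N(1)[of "\<lambda>x. x"]) auto
      show "char (?D M) = char (?D N)"
      proof
        fix t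
        have "char (?D M) t = (CLINT x|M. (u x / c) *\<^sub>R iexp (t * f x))"
          unfolding char_def by (rule M(2)) auto
        also have "\<dots> = (CLINT x|M. of_real (u x) * iexp (t * f x)) / c"
          by (subst integral_divide_zero[symmetric]) (simp add: scaleR_conv_of_real)
        also have "\<dots> = (CLINT x|N. of_real (u x) * iexp (t * f x)) / c" by (simp only: cf)
        also have "\<dots> = (CLINT x|N. (u x / c) *\<^sub>R iexp (t * f x))"
          by (subst integral_divide_zero[symmetric]) (simp add: scaleR_conv_of_real)
        also have "\<dots> = char (?D N) t"
          unfolding char_def by (rule N(2)[symmetric]) auto
        finally show "char (?D M) t = char (?D N) t" .
      qed
    qed
    have "(LINT x|M. (u x / c) *\<^sub>R indicator B (f x)) = (LINT x|?D M. indicator B x :: real)"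
      by (rule M(2)[symmetric]) auto
    also have "\<dots> = (LINT x|N. (u x / c) *\<^sub>R indicator B (f x))"
      unfolding eq by (rule N(2)) auto
    finally show ?thesis using \<open>0 < c\<close> by simp
  qed
qed

text \<open>This replaces a multivariate Levy theorem. The indicators of the constraints \<open>f \<in> B\<close> are
introduced one at a time. With the constraints treated so far and a factor \<open>1 + cos g\<close> or
\<open>1 + sin g\<close> as the weight \<open>u\<close>, the one-dimensional theorem adds the next constraint while keeping
an arbitrary oscillating factor, which is what the next step needs.\<close>

theorem linear_family_uniqueness:
  fixes V :: "('a \<Rightarrow> real) set"
  assumes "finite_measure M" "finite_measure N" and sets: "sets M = sets N"
    and V: "linear_family V" "V \<subseteq> borel_measurable M"
    and cf: "\<And>f. f \<in> V \<Longrightarrow> (CLINT x|M. iexp (f x)) = (CLINT x|N. iexp (f x))"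
    and A: "A \<in> events_of M V"
  shows "measure M A = measure N A"
proof -
  interpret M: finite_measure M by fact
  interpret N: finite_measure N by fact
  have sp: "space M = space N" using sets by (rule sets_eq_imp_space_eq)
  have V_lin: "(\<lambda>_. 0) \<in> V" "\<And>f g. f \<in> V \<Longrightarrow> g \<in> V \<Longrightarrow> (\<lambda>x. f x + g x) \<in> V"
      "\<And>c f. f \<in> V \<Longrightarrow> (\<lambda>x. c * f x) \<in> V"
    using V(1) by (auto simp: linear_family_def)
  have V_meas: "f \<in> borel_measurable M" "f \<in> borel_measurable N" if "f \<in> V" for f
    using V(2) that sets by (auto cong: measurable_cong_sets)
  define w where "w js x = (\<Prod>(f, B) \<leftarrow> js. indicator B (f x) :: real)" for js :: "(('a \<Rightarrow> real) \<times> real set) list" and x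
  define ok where "ok js \<longleftrightarrow> set js \<subseteq> V \<times> sets (borel :: real measure)" for js
  have w_Nil: "w [] x = 1" and w_Cons: "w ((f, B) # js) x = w js x * indicator B (f x)" for f B js x
    by (simp_all add: w_def)
  have w_bd: "0 \<le> w js x" "w js x \<le> 1" for js x
    by (induction js) (auto simp: w_Nil w_Cons intro: mult_le_one simp: indicator_def)
  have w_abs: "\<bar>w js x\<bar> \<le> 1" for js x using w_bd[of js x] by auto
  have w_meas: "w js \<in> borel_measurable M \<and> w js \<in> borel_measurable N" if "ok js" for js
    using that
  proof (induction js)
    case (Cons p js)
    obtain f B where p: "p = (f, B)" by force
    have *: "f \<in> V" "B \<in> sets borel" "ok js" using Cons.prems by (auto simp: ok_def p)
    have [measurable]: "w js \<in> borel_measurable M" "w js \<in> borel_measurable N" 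
      "f \<in> borel_measurable M" "f \<in> borel_measurable N" "B \<in> sets borel"
      using Cons.IH[OF *(3)] V_meas[OF *(1)] *(2) by auto
    show ?case unfolding p w_Cons by measurable
  qed (simp add: w_Nil[abs_def])
  have claim: "(CLINT x|M. of_real (w js x) * iexp (g x)) = (CLINT x|N. of_real (w js x) * iexp (g x))"
    if "ok js" "g \<in> V" for js g
    using that
  proof (induction js arbitrary: g)
    case Nil
    then show ?case using cf[of g] by (simp add: w_Nil)
  next
    case (Cons p js)
    obtain f B where p: "p = (f, B)" by force
    have *: "f \<in> V" "ok js" and [measurable]: "B \<in> sets borel" using Cons.prems by (auto simp: ok_def p)
    note g = \<open>g \<in> V\<close>
    have [measurable]: "w js \<in> borel_measurable M" "w js \<in> borel_measurable N"
      "w (p # js) \<in> borel_measurable M" "w (p # js) \<in> borel_measurable N"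
      "f \<in> borel_measurable M" "f \<in> borel_measurable N" "g \<in> borel_measurable M" "g \<in> borel_measurable N"
      using w_meas[OF *(2)] w_meas[OF Cons.prems(1)] V_meas[OF *(1)] V_meas[OF g] by auto
    have mem: "(\<lambda>x. t * f x) \<in> V" "(\<lambda>x. t * f x + g x) \<in> V" "(\<lambda>x. t * f x - g x) \<in> V" for t
      using V_lin(2)[OF V_lin(3)[OF *(1), of t] g] V_lin(3)[OF *(1), of t]
        V_lin(2)[OF V_lin(3)[OF *(1), of t] V_lin(3)[OF g, of "-1"]] by auto
    note IH = Cons.IH[OF *(2)]
    have trig: "0 \<le> 1 + cos y" "1 + cos y \<le> 2" "0 \<le> 1 + sin y" "1 + sin y \<le> 2" for y :: real
      using cos_ge_minus_one[of y] sin_ge_minus_one[of y] cos_le_one[of y] sin_le_one[of y] by linarith+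
    have 1: "(LINT x|M. w js x * indicator B (f x)) = (LINT x|N. w js x * indicator B (f x))"
      by (rule weighted_Levy_uniqueness[where C = 1, OF assms(1-3) _ _ _ _ _ IH[OF mem(1)]]) (simp_all add: w_bd)
    have 2: "(LINT x|M. (w js x * (1 + cos (g x))) * indicator B (f x)) = (LINT x|N. (w js x * (1 + cos (g x))) * indicator B (f x))"
    proof (rule weighted_Levy_uniqueness[where C = 2])
      show "w js x * (1 + cos (g x)) \<le> 2" for x
        using mult_mono[OF w_bd(2)[of js x] trig(2)[of "g x"]] trig(1) w_bd by auto
      show "(CLINT x|M. of_real (w js x * (1 + cos (g x))) * iexp (t * f x)) =
        (CLINT x|N. of_real (w js x * (1 + cos (g x))) * iexp (t * f x))" for t
        by (subst M.integral_cos_weight[OF _ _ _ w_abs], simp, simp, simp)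
          (subst N.integral_cos_weight[OF _ _ _ w_abs], simp, simp, simp, simp only: IH[OF mem(1)] IH[OF mem(2)] IH[OF mem(3)])
    qed (use w_bd trig assms in auto)
    have 3: "(LINT x|M. (w js x * (1 + sin (g x))) * indicator B (f x)) = (LINT x|N. (w js x * (1 + sin (g x))) * indicator B (f x))"
    proof (rule weighted_Levy_uniqueness[where C = 2])
      show "w js x * (1 + sin (g x)) \<le> 2" for x
        using mult_mono[OF w_bd(2)[of js x] trig(4)[of "g x"]] trig(3) w_bd by auto
      show "(CLINT x|M. of_real (w js x * (1 + sin (g x))) * iexp (t * f x)) =
        (CLINT x|N. of_real (w js x * (1 + sin (g x))) * iexp (t * f x))" for t
        by (subst M.integral_sin_weight[OF _ _ _ w_abs], simp, simp, simp)
          (subst N.integral_sin_weight[OF _ _ _ w_abs], simp, simp, simp, simp only: IH[OF mem(1)] IH[OF mem(2)] IH[OF mem(3)])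
    qed (use w_bd trig assms in auto)
    show ?case
      apply (subst M.integral_iexp_weights[OF _ _ w_abs], simp, simp)
      apply (subst N.integral_iexp_weights[OF _ _ w_abs], simp, simp)
      using 1 2 3 by (simp add: p w_Cons[abs_def] mult_ac)
  qed
  define cyl where "cyl js = {x \<in> space M. \<forall>(f, B) \<in> set js. f x \<in> B}" for js :: "(('a \<Rightarrow> real) \<times> real set) list"
  define G where "G = cyl ` {js. ok js}"
  have w_cyl: "w js x = indicator (cyl js) x" if "x \<in> space M" for js x
  proof (induction js)
    case Nil
    then show ?case using that by (simp add: w_Nil cyl_def)
  next
    case (Cons p js)
    obtain f B where p: "p = (f, B)" by force
    have "x \<in> cyl (p # js) \<longleftrightarrow> x \<in> cyl js \<and> f x \<in> B" by (auto simp: cyl_def p)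
    then show ?case using Cons by (simp add: p w_Cons indicator_def)
  qed
  have cyl_eq: "measure M (cyl js) = measure N (cyl js)" and cyl_sets: "cyl js \<in> sets M" if "ok js" for js
  proof -
    note [measurable] = conjunct1[OF w_meas[OF that]]
    have "cyl js = {x \<in> space M. w js x = 1}" using w_cyl by (auto simp: cyl_def indicator_def split: if_splits)
    also have "\<dots> \<in> sets M" by measurable
    finally show S: "cyl js \<in> sets M" .
    have "measure M (cyl js) = (LINT x|M. w js x)" "measure N (cyl js) = (LINT x|N. w js x)"
    proof -
      have "(LINT x|M. w js x) = (LINT x|M. indicator (cyl js) x)"
        "(LINT x|N. w js x) = (LINT x|N. indicator (cyl js) x)"
        by (rule Bochner_Integration.integral_cong; simp add: w_cyl sp)+
      then show "measure M (cyl js) = (LINT x|M. w js x)" "measure N (cyl js) = (LINT x|N. w js x)"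
        using S sets by auto
    qed
    moreover have "of_real (LINT x|M. w js x) = complex_of_real (LINT x|N. w js x)"
      using claim[OF that V_lin(1)] by simp
    ultimately show "measure M (cyl js) = measure N (cyl js)" by simp
  qed
  have G_sub: "G \<subseteq> Pow (space M)" by (auto simp: G_def cyl_def)
  have Int: "Int_stable G"
  proof (rule Int_stableI)
    fix a b assume "a \<in> G" "b \<in> G"
    then obtain i j where ij: "a = cyl i" "b = cyl j" "ok i" "ok j" by (auto simp: G_def)
    then have "a \<inter> b = cyl (i @ j)" "ok (i @ j)" by (auto simp: cyl_def ok_def)
    then show "a \<inter> b \<in> G" by (auto simp: G_def)
  qed
  have "{f -` B \<inter> space M | f B. f \<in> V \<and> B \<in> sets borel} \<subseteq> G"
  proof clarify
    fix f and B :: "real set" assume "f \<in> V" "B \<in> sets borel"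
    then have "f -` B \<inter> space M = cyl [(f, B)]" "ok [(f, B)]" by (auto simp: cyl_def ok_def)
    then show "f -` B \<inter> space M \<in> G" by (auto simp: G_def)
  qed
  then have A_sigma: "A \<in> sigma_sets (space M) G"
    using A sigma_sets_mono' unfolding events_of_def by blast
  have G_sets: "sigma_sets (space M) G \<subseteq> sets M"
    using cyl_sets by (intro sets.sigma_sets_subset) (auto simp: G_def)
  from A_sigma show ?thesis
  proof (induction rule: sigma_sets_induct_disjoint[OF Int G_sub, consumes 1])
    case (1 A)
    then show ?case using cyl_eq by (auto simp: G_def)
  next
    case 2
    show ?case by simp
  next
    case (3 A)
    have "measure M (space M) = measure N (space M)"
      using cyl_eq[of "[]"] by (simp add: cyl_def ok_def)
    moreover have "A \<in> sets M" "A \<in> sets N" using 3(1) G_sets sets by auto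
    ultimately show ?case
      using M.finite_measure_compl[of A] N.finite_measure_compl[of A] 3(2) by (simp add: sp)
  next
    case (4 A)
    then have A: "range A \<subseteq> sets M" using G_sets by auto
    have "(\<lambda>i. measure M (A i)) sums measure M (\<Union>i. A i)"
      using M.finite_measure_UNION[OF A 4(1)] .
    moreover have "(\<lambda>i. measure N (A i)) sums measure N (\<Union>i. A i)"
      using A sets by (intro N.finite_measure_UNION 4(1)) auto
    ultimately show ?case using 4 by (simp add: sums_unique2)
  qed
qed

text \<open>The measures with density \<open>u\<close> and with constant density \<open>E u\<close> have the same characteristic
functions along \<open>V\<close>.\<close>

lemma (in prob_space) weight_independent_of_family:
  fixes V :: "('a \<Rightarrow> real) set" and u :: "'a \<Rightarrow> real"
  assumes V: "linear_family V" "V \<subseteq> borel_measurable M" and A: "A \<in> events_of M V"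
    and [measurable]: "u \<in> borel_measurable M" and u: "\<And>x. 0 \<le> u x" "\<And>x. u x \<le> C"
    and eq: "\<And>f. f \<in> V \<Longrightarrow>
      (CLINT x|M. of_real (u x) * iexp (f x)) = of_real (expectation u) * (CLINT x|M. iexp (f x))"
  shows "(LINT x|M. indicator A x * u x) = prob A * expectation u"
proof -
  let ?M = "density M (\<lambda>x. ennreal (u x))" and ?N = "density M (\<lambda>x. ennreal (expectation u))"
  have nn: "0 \<le> expectation u" using u by (intro integral_nonneg_AE) auto
  have [measurable]: "A \<in> sets M" using A V(2) events_of_subset by blast
  have fin: "finite_measure ?M" "finite_measure ?N"
  proof -
    have "(\<integral>\<^sup>+x. ennreal (u x) \<partial>M) \<le> (\<integral>\<^sup>+x. ennreal C \<partial>M)"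
      using u by (intro nn_integral_mono ennreal_leI) auto
    then have "(\<integral>\<^sup>+x. ennreal (u x) \<partial>M) < \<infinity>"
      by (rule le_less_trans) (simp add: emeasure_space_1 ennreal_mult_less_top)
    then show "finite_measure ?M"
      by (intro finite_measureI) (simp add: emeasure_density cong: nn_integral_cong)
    show "finite_measure ?N"
      by (intro finite_measureI) (simp add: emeasure_density emeasure_space_1 cong: nn_integral_cong)
  qed
  have m: "measure ?M A = (LINT x|M. indicator A x * u x)" "measure ?N A = prob A * expectation u"
  proof -
    have "integral\<^sup>L ?M (indicator A :: _ \<Rightarrow> real) = (LINT x|M. u x *\<^sub>R indicator A x)"
      using u by (subst integral_density) auto
    then show "measure ?M A = (LINT x|M. indicator A x * u x)" by (simp add: mult.commute)
    have "integral\<^sup>L ?N (indicator A :: _ \<Rightarrow> real) = (LINT x|M. expectation u *\<^sub>R indicator A x)"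
      using nn by (subst integral_density) auto
    then show "measure ?N A = prob A * expectation u" by (simp add: mult.commute)
  qed
  have "measure ?M A = measure ?N A"
  proof (rule linear_family_uniqueness[OF fin _ V(1)])
    show "A \<in> events_of ?M V" using A by (simp add: events_of_def)
    fix f assume f: "f \<in> V"
    then have [measurable]: "f \<in> borel_measurable M" using V by auto
    have "(CLINT x|?M. iexp (f x)) = (CLINT x|M. u x *\<^sub>R iexp (f x))"
      using u by (subst integral_density) auto
    also have "\<dots> = (CLINT x|M. expectation u *\<^sub>R iexp (f x))"
      using eq[OF f] by (simp add: scaleR_conv_of_real)
    also have "\<dots> = (CLINT x|?N. iexp (f x))"
      using nn by (subst integral_density) auto
    finally show "(CLINT x|?M. iexp (f x)) = (CLINT x|?N. iexp (f x))" .
  qed (use V in auto)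
  with m show ?thesis by simp
qed

text \<open>The previous lemma is used twice, first with the trigonometric weights built from \<open>W\<close>, then with the
indicator of an event of \<open>V\<close> as the weight.\<close>

theorem (in prob_space) linear_families_independent:
  fixes V W :: "('a \<Rightarrow> real) set"
  assumes V: "linear_family V" "V \<subseteq> borel_measurable M"
    and W: "linear_family W" "W \<subseteq> borel_measurable M"
    and cf: "\<And>f g. f \<in> V \<Longrightarrow> g \<in> W \<Longrightarrow>
      (CLINT x|M. iexp (f x + g x)) = (CLINT x|M. iexp (f x)) * (CLINT x|M. iexp (g x))"
    and A: "A \<in> events_of M V" and B: "B \<in> events_of M W"
  shows "prob (A \<inter> B) = prob A * prob B"
proof -
  have [measurable]: "A \<in> sets M" "B \<in> sets M"
    using A B V(2) W(2) events_of_subset by blast+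
  have trig: "0 \<le> 1 + cos y" "1 + cos y \<le> 2" "0 \<le> 1 + sin y" "1 + sin y \<le> 2" for y :: real
    using cos_ge_minus_one[of y] sin_ge_minus_one[of y] cos_le_one[of y] sin_le_one[of y] by linarith+
  have step: "(CLINT x|M. of_real (indicator A x) * iexp (g x)) = of_real (prob A) * (CLINT x|M. iexp (g x))"
    if g: "g \<in> W" for g
  proof -
    have [measurable]: "g \<in> borel_measurable M" using g W(2) by blast
    have "(\<lambda>x. (-1) * g x) \<in> W" using W(1) g unfolding linear_family_def by blast
    then have neg: "(\<lambda>x. - g x) \<in> W" by simp
    have cf': "(CLINT x|M. iexp (f x - g x)) = (CLINT x|M. iexp (f x)) * (CLINT x|M. iexp (- g x))" if "f \<in> V" for f
      using cf[OF that neg] by simp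
    have one: "\<bar>1::real\<bar> \<le> 1" by simp
    note cosw = integral_cos_weight[where w = "\<lambda>_. 1", OF borel_measurable_const _ _ one, simplified mult_1_left of_real_1]
    note sinw = integral_sin_weight[where w = "\<lambda>_. 1", OF borel_measurable_const _ _ one, simplified mult_1_left of_real_1]
    have f_meas [measurable_dest]: "f \<in> borel_measurable M" if "f \<in> V" for f using V(2) that by blast
    have cos0: "complex_of_real (expectation (\<lambda>x. 1 + cos (g x))) = 1 + (CLINT x|M. iexp (g x)) / 2 + (CLINT x|M. iexp (- g x)) / 2"
      unfolding integral_complex_of_real[symmetric] using cosw[of "\<lambda>_. 0" g] by (simp add: prob_space)
    have sin0: "complex_of_real (expectation (\<lambda>x. 1 + sin (g x))) = 1 + (CLINT x|M. iexp (g x)) / (2 * \<i>) - (CLINT x|M. iexp (- g x)) / (2 * \<i>)"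
      unfolding integral_complex_of_real[symmetric] using sinw[of "\<lambda>_. 0" g] by (simp add: prob_space)
    have c: "(LINT x|M. indicator A x * (1 + cos (g x))) = prob A * expectation (\<lambda>x. 1 + cos (g x))"
    proof (rule weight_independent_of_family[where C = 2, OF V A])
      fix f assume f: "f \<in> V"
      show "(CLINT x|M. of_real (1 + cos (g x)) * iexp (f x)) = of_real (expectation (\<lambda>x. 1 + cos (g x))) * (CLINT x|M. iexp (f x))"
        unfolding cosw[OF f_meas[OF f] \<open>g \<in> borel_measurable M\<close>] cf[OF f g] cf'[OF f] cos0
        by (simp only: algebra_simps) simp
    next
      show "1 + cos (g x) \<le> 2" for x by (rule trig)
    qed (use trig in auto)
    have s: "(LINT x|M. indicator A x * (1 + sin (g x))) = prob A * expectation (\<lambda>x. 1 + sin (g x))"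
    proof (rule weight_independent_of_family[where C = 2, OF V A])
      fix f assume f: "f \<in> V"
      show "(CLINT x|M. of_real (1 + sin (g x)) * iexp (f x)) = of_real (expectation (\<lambda>x. 1 + sin (g x))) * (CLINT x|M. iexp (f x))"
        unfolding sinw[OF f_meas[OF f] \<open>g \<in> borel_measurable M\<close>] cf[OF f g] cf'[OF f] sin0
        by (simp only: algebra_simps) simp
    next
      show "1 + sin (g x) \<le> 2" for x by (rule trig)
    qed (use trig in auto)
    have "(CLINT x|M. of_real (indicator A x) * iexp (g x)) =
      of_real (prob A * expectation (\<lambda>x. 1 + cos (g x))) + \<i> * of_real (prob A * expectation (\<lambda>x. 1 + sin (g x)))
      - (1 + \<i>) * of_real (prob A)"
      by (subst integral_iexp_weights[where C = 1], simp, simp, simp) (simp add: c s)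
    also have "\<dots> = of_real (prob A) * (of_real (expectation (\<lambda>x. 1 + cos (g x)))
        + \<i> * of_real (expectation (\<lambda>x. 1 + sin (g x))) - (1 + \<i>))"
      by (simp only: of_real_mult) (simp only: algebra_simps mult_1_right)
    also have "of_real (expectation (\<lambda>x. 1 + cos (g x)))
        + \<i> * of_real (expectation (\<lambda>x. 1 + sin (g x))) - (1 + \<i>) = (CLINT x|M. iexp (g x))"
      using integral_iexp_weights[where w = "\<lambda>_. 1" and C = 1 and g = g] by (simp add: prob_space)
    finally show ?thesis .
  qed
  have "(LINT x|M. indicator B x * indicator A x) = prob B * expectation (indicator A)"
  proof (rule weight_independent_of_family[where C = 1, OF W B])
    show "indicator A x \<le> (1 :: real)" for x by (simp add: indicator_def)
  qed (use step in auto)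
  then show ?thesis by (simp add: indicator_inter_arith[symmetric] Int_commute)
qed

section \<open>Interpolation and Borel sets in C(D)\<close>

lemma apply_Bcontfun:
  fixes f :: "'d::metric_space \<Rightarrow> real"
  assumes "compact (UNIV :: 'd set)" "continuous_on UNIV f"
  shows "apply_bcontfun (Bcontfun f) = f"
proof (rule Bcontfun_inverse)
  show "f \<in> bcontfun"
    using compact_continuous_image[OF assms(2,1)] assms(2)
    by (auto simp: bcontfun_def intro: compact_imp_bounded)
qed

lemma apply_bcontfun_sum:
  "apply_bcontfun (\<Sum>i\<in>I. f i :: 'd::metric_space \<Rightarrow>\<^sub>C real) x = (\<Sum>i\<in>I. apply_bcontfun (f i) x)"
  by (induction I rule: infinite_finite_induct) auto

text \<open>A partition of unity subordinate to balls of radius \<open>1 / (n + 1)\<close> interpolates \<open>f\<close> with an error bounded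
by the oscillation of \<open>f\<close> at that scale. Every bounded functional on \<open>C(D)\<close> is thereby a pointwise
limit of finite combinations of evaluations.\<close>

lemma bcontfun_interpolation:
  assumes compact: "compact (UNIV :: 'd::metric_space set)"
  obtains S :: "nat \<Rightarrow> 'd::metric_space set" and \<phi> :: "nat \<Rightarrow> 'd \<Rightarrow> 'd \<Rightarrow>\<^sub>C real"
  where "\<And>n. finite (S n)" "\<And>f. (\<lambda>n. \<Sum>s\<in>S n. apply_bcontfun f s *\<^sub>R \<phi> n s) \<longlonglongrightarrow> f"
proof -
  have "\<exists>S :: 'd set. finite S \<and> (\<forall>x. \<exists>s\<in>S. dist s x < 1 / real (Suc n))" for n
  proof -
    obtain S :: "'d set" where "finite S" "UNIV \<subseteq> (\<Union>s\<in>S. ball s (1 / real (Suc n)))"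
      using compact unfolding compact_eq_totally_bounded by (meson of_nat_0_less_iff zero_less_Suc zero_less_divide_1_iff)
    then show ?thesis by (intro exI[of _ S]) (auto simp: subset_eq)
  qed
  then obtain S :: "nat \<Rightarrow> 'd set" where fin: "\<And>n. finite (S n)"
    and S: "\<And>n x. \<exists>s\<in>S n. dist s x < 1 / real (Suc n)" by metis
  define \<psi> where "\<psi> n s x = max 0 (1 / real (Suc n) - dist s x)" for n and s x :: 'd
  define tot where "tot n x = (\<Sum>s\<in>S n. \<psi> n s x)" for n x
  define \<phi> where "\<phi> n s = Bcontfun (\<lambda>x. \<psi> n s x / tot n x)" for n s
  have \<psi>_nonneg: "0 \<le> \<psi> n s x" for n s x by (simp add: \<psi>_def)
  have tot_pos: "0 < tot n x" for n x
  proof -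
    obtain s where "s \<in> S n" "dist s x < 1 / real (Suc n)" using S by blast
    then show ?thesis unfolding tot_def using fin \<psi>_nonneg
      by (intro sum_pos2[of _ s]) (auto simp: \<psi>_def)
  qed
  have \<psi>_cont: "continuous_on UNIV (\<psi> n s)" for n s
    unfolding \<psi>_def[abs_def] by (intro continuous_intros)
  have "continuous_on UNIV (\<lambda>x. \<psi> n s x / tot n x)" for n s
    using tot_pos unfolding tot_def by (intro continuous_intros \<psi>_cont) (simp add: less_imp_neq[symmetric])
  then have \<phi>: "apply_bcontfun (\<phi> n s) x = \<psi> n s x / tot n x" for n s x
    unfolding \<phi>_def by (simp add: apply_Bcontfun[OF compact])
  have \<phi>_sum: "(\<Sum>s\<in>S n. apply_bcontfun (\<phi> n s) x) = 1" for n x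
    using tot_pos[of n x] by (simp add: \<phi> sum_divide_distrib[symmetric] tot_def)
  have "(\<lambda>n. \<Sum>s\<in>S n. apply_bcontfun f s *\<^sub>R \<phi> n s) \<longlonglongrightarrow> f" for f :: "'d \<Rightarrow>\<^sub>C real"
  proof (rule metric_LIMSEQ_I)
    fix e :: real assume "0 < e"
    have "uniformly_continuous_on UNIV (apply_bcontfun f)"
      by (rule compact_uniformly_continuous[OF _ compact]) auto
    then obtain d where d: "0 < d" "\<And>x y. dist x y < d \<Longrightarrow> dist (apply_bcontfun f x) (apply_bcontfun f y) < e / 2"
      using \<open>0 < e\<close> unfolding uniformly_continuous_on_def by (metis UNIV_I half_gt_zero dist_commute)
    obtain N where N: "1 / real (Suc N) < d" using nat_approx_posE[OF d(1)] by auto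
    have "dist (\<Sum>s\<in>S n. apply_bcontfun f s *\<^sub>R \<phi> n s) f \<le> e / 2" if "N \<le> n" for n
    proof (rule dist_bound)
      fix x
      have "1 / real (Suc n) \<le> 1 / real (Suc N)" using that by (simp add: frac_le)
      then have near: "dist s x < d" if "\<psi> n s x \<noteq> 0" for s
        using that N by (auto simp: \<psi>_def max_def split: if_splits)
      have "apply_bcontfun (\<Sum>s\<in>S n. apply_bcontfun f s *\<^sub>R \<phi> n s) x - apply_bcontfun f x =
          (\<Sum>s\<in>S n. apply_bcontfun f s * apply_bcontfun (\<phi> n s) x) - apply_bcontfun f x * (\<Sum>s\<in>S n. apply_bcontfun (\<phi> n s) x)"
        by (simp add: apply_bcontfun_sum \<phi>_sum)
      also have "\<dots> = (\<Sum>s\<in>S n. (apply_bcontfun f s - apply_bcontfun f x) * apply_bcontfun (\<phi> n s) x)"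
        by (simp add: sum_distrib_left sum_subtractf left_diff_distrib)
      also have "\<bar>\<dots>\<bar> \<le> (\<Sum>s\<in>S n. e / 2 * apply_bcontfun (\<phi> n s) x)"
      proof (rule order_trans[OF sum_abs sum_mono])
        fix s
        show "\<bar>(apply_bcontfun f s - apply_bcontfun f x) * apply_bcontfun (\<phi> n s) x\<bar> \<le> e / 2 * apply_bcontfun (\<phi> n s) x"
        proof (cases "\<psi> n s x = 0")
          case False
          then have "\<bar>apply_bcontfun f s - apply_bcontfun f x\<bar> \<le> e / 2"
            using d(2)[OF near] by (simp add: dist_real_def less_imp_le)
          moreover have "0 \<le> apply_bcontfun (\<phi> n s) x"
            using \<psi>_nonneg[of n s x] tot_pos[of n x] by (simp add: \<phi>)
          ultimately show ?thesis unfolding abs_mult by (simp only: abs_of_nonneg mult_right_mono)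
        qed (simp add: \<phi>)
      qed
      also have "\<dots> = e / 2" by (subst sum_distrib_left[symmetric]) (simp add: \<phi>_sum)
      finally show "dist (apply_bcontfun (\<Sum>s\<in>S n. apply_bcontfun f s *\<^sub>R \<phi> n s) x) (apply_bcontfun f x) \<le> e / 2"
        by (simp add: dist_real_def)
    qed
    then show "\<exists>N. \<forall>n\<ge>N. dist (\<Sum>s\<in>S n. apply_bcontfun f s *\<^sub>R \<phi> n s) f < e"
      using \<open>0 < e\<close> by (intro exI[of _ N]) force
  qed
  with fin that show thesis by blast
qed

definition eval :: "'d::metric_space \<Rightarrow> ('d \<Rightarrow>\<^sub>C real) \<Rightarrow>\<^sub>L real" where
  "eval s = Blinfun (\<lambda>f. apply_bcontfun f s)"

lemma eval_apply [simp]: "blinfun_apply (eval s) f = apply_bcontfun f s"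
proof -
  have "bounded_linear (\<lambda>f :: 'a \<Rightarrow>\<^sub>C real. apply_bcontfun f s)"
  proof (rule bounded_linear_intro[where K = 1])
    show "norm (apply_bcontfun f s) \<le> norm f * 1" for f :: "'a \<Rightarrow>\<^sub>C real"
      using norm_bounded[of f s] by simp
  qed auto
  then show ?thesis by (simp add: eval_def bounded_linear_Blinfun_apply)
qed

text \<open>The interpolants of \<open>X\<close> are continuous functions of finitely many real random variables, hence
measurable, and measurability passes to their limit \<open>X\<close>.\<close>

lemma borel_measurable_bcontfunI:
  fixes X :: "'a \<Rightarrow> 'd::metric_space \<Rightarrow>\<^sub>C real"
  assumes compact: "compact (UNIV :: 'd set)"
    and X: "\<And>s. (\<lambda>\<omega>. apply_bcontfun (X \<omega>) s) \<in> borel_measurable M"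
  shows "X \<in> borel_measurable M"
proof -
  obtain S :: "nat \<Rightarrow> 'd set" and \<phi> :: "nat \<Rightarrow> 'd \<Rightarrow> 'd \<Rightarrow>\<^sub>C real"
    where fin: "\<And>n. finite (S n)"
      and lim: "\<And>f. (\<lambda>n. \<Sum>s\<in>S n. apply_bcontfun f s *\<^sub>R \<phi> n s) \<longlonglongrightarrow> f"
    using bcontfun_interpolation[OF compact] by metis
  show ?thesis
  proof (rule borel_measurable_LIMSEQ_metric)
    show "(\<lambda>n. \<Sum>s\<in>S n. apply_bcontfun (X \<omega>) s *\<^sub>R \<phi> n s) \<longlonglongrightarrow> X \<omega>" for \<omega> by (rule lim)
    fix n
    \<comment> \<open>The finite set is enumerated so that the coordinates live in a countable product of reals.\<close>
    define r where "r \<omega> i = apply_bcontfun (X \<omega>) (from_nat_into (S n) i)" for \<omega> and i :: nat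
    have "r \<in> borel_measurable M"
      by (rule measurable_coordinatewise_then_product) (simp add: r_def X)
    moreover have "continuous_on UNIV (\<lambda>q :: nat \<Rightarrow> real. \<Sum>s\<in>S n. q (to_nat_on (S n) s) *\<^sub>R \<phi> n s)"
      by (intro continuous_intros continuous_on_product_coordinates)
    then have "(\<lambda>q :: nat \<Rightarrow> real. \<Sum>s\<in>S n. q (to_nat_on (S n) s) *\<^sub>R \<phi> n s) \<in> borel_measurable borel"
      by (rule borel_measurable_continuous_onI)
    ultimately have "(\<lambda>\<omega>. \<Sum>s\<in>S n. r \<omega> (to_nat_on (S n) s) *\<^sub>R \<phi> n s) \<in> borel_measurable M"
      by (rule measurable_compose)
    moreover have "r \<omega> (to_nat_on (S n) s) = apply_bcontfun (X \<omega>) s" if "s \<in> S n" for \<omega> s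
      using that by (simp add: r_def countable_finite[OF fin])
    ultimately show "(\<lambda>\<omega>. \<Sum>s\<in>S n. apply_bcontfun (X \<omega>) s *\<^sub>R \<phi> n s) \<in> borel_measurable M"
      by simp
  qed
qed

lemma borel_eq_events_ofI:
  fixes V :: "('a::topological_space \<Rightarrow> real) set"
  assumes V: "V \<subseteq> borel_measurable borel"
    and gen: "\<And>M :: 'a measure. space M = UNIV \<Longrightarrow> V \<subseteq> borel_measurable M \<Longrightarrow> (\<lambda>x. x) \<in> borel_measurable M"
  shows "events_of borel V = sets borel"
proof
  show "events_of borel V \<subseteq> sets borel" by (rule events_of_subset[OF V])
  let ?M = "sigma UNIV {f -` B | f B. f \<in> V \<and> B \<in> sets borel}"
  have sets: "sets ?M = events_of borel V" by (simp add: events_of_def sets_measure_of)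
  have "V \<subseteq> borel_measurable ?M" by (auto intro!: measurableI)
  then have "(\<lambda>x. x) \<in> borel_measurable ?M" by (intro gen) (auto simp: space_measure_of_conv)
  then show "sets borel \<subseteq> events_of borel V"
  proof -
    have "A \<in> sets ?M" if "A \<in> sets borel" for A
      using measurable_sets[OF \<open>(\<lambda>x. x) \<in> borel_measurable ?M\<close> that] by (simp add: space_measure_of_conv)
    then show ?thesis using sets by blast
  qed
qed

lemma borel_measurable_blinfun:
  fixes L :: "'a::real_normed_vector \<Rightarrow>\<^sub>L 'b::real_normed_vector"
  shows "blinfun_apply L \<in> borel_measurable borel"
  by (intro borel_measurable_continuous_onI linear_continuous_on blinfun.bounded_linear_right)

lemma borel_bcontfun_eq_events_of:
  assumes "compact (UNIV :: 'd::metric_space set)"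
  shows "events_of borel (range blinfun_apply) = sets (borel :: ('d \<Rightarrow>\<^sub>C real) measure)"
proof (rule borel_eq_events_ofI)
  show "range blinfun_apply \<subseteq> borel_measurable (borel :: ('d \<Rightarrow>\<^sub>C real) measure)"
    by (intro image_subsetI borel_measurable_blinfun)
  fix M :: "('d \<Rightarrow>\<^sub>C real) measure"
  assume "range (blinfun_apply :: _ \<Rightarrow>\<^sub>L real \<Rightarrow> _) \<subseteq> borel_measurable M"
  then have "blinfun_apply (eval s) \<in> borel_measurable M" for s
    by (rule subsetD) (rule rangeI)
  moreover have "blinfun_apply (eval s) = (\<lambda>f. apply_bcontfun f s)" for s :: 'd by (rule ext) simp
  ultimately show "(\<lambda>x. x) \<in> borel_measurable M"
    by (intro borel_measurable_bcontfunI[OF assms]) simp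
qed

lemma borel_vec_eq_events_of:
  "events_of borel (range (\<lambda>b x. b \<bullet> x)) = sets (borel :: (real ^ 'n) measure)"
proof (rule borel_eq_events_ofI)
  fix M :: "(real ^ 'n) measure"
  assume "range (\<lambda>b x. b \<bullet> x) \<subseteq> borel_measurable M"
  then have "(\<lambda>x. b \<bullet> x) \<in> borel_measurable M" for b by blast
  then show "(\<lambda>x. x) \<in> borel_measurable M"
    by (subst borel_measurable_euclidean_space) (simp add: inner_commute)
qed auto

lemma vimage_events_of:
  assumes A: "A \<in> events_of N W" and R: "R \<in> space M \<rightarrow> space N"
    and V: "\<And>f. f \<in> W \<Longrightarrow> (\<lambda>x. f (R x)) \<in> V"
  shows "R -` A \<inter> space M \<in> events_of M V"
  using A unfolding events_of_def
proof (induction A rule: sigma_sets.induct)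
  case (Basic a)
  then obtain f B where "a = f -` B \<inter> space N" "f \<in> W" "B \<in> sets borel" by auto
  then have "R -` a \<inter> space M = (\<lambda>x. f (R x)) -` B \<inter> space M" using R by auto
  then show ?case using V \<open>f \<in> W\<close> \<open>B \<in> sets borel\<close> by (intro sigma_sets.Basic) blast
next
  case Empty
  show ?case by (simp add: sigma_sets.Empty)
next
  case (Compl a)
  have "R -` (space N - a) \<inter> space M = space M - (R -` a \<inter> space M)" using R by auto
  then show ?case using Compl by (simp add: sigma_sets.Compl)
next
  case (Union a)
  have "R -` (\<Union>i. a i) \<inter> space M = (\<Union>i. R -` a i \<inter> space M)" by auto
  then show ?case using sigma_sets.Union[OF Union.IH] by simp
qed

section \<open>Gaussian measures on normed spaces\<close>

lemma (in prob_space) gaussian_rv_interval_pos: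
  assumes X: "gaussian_rv M X" and v: "0 < var X" and "0 < e"
  shows "0 < prob {\<omega> \<in> space M. \<bar>X \<omega> - y\<bar> < e}"
proof -
  have meas [measurable]: "X \<in> borel_measurable M" using X by (rule gaussian_rv_measurable)
  from X consider \<mu> \<sigma> where "0 < \<sigma>" "distributed M lborel X (\<lambda>x. ennreal (normal_density \<mu> \<sigma> x))"
    | c where "AE \<omega> in M. X \<omega> = c" unfolding gaussian_rv_def by blast
  then show ?thesis
  proof cases
    case (1 \<mu> \<sigma>)
    let ?B = "{y - e<..<y + e}"
    have "emeasure M (X -` ?B \<inter> space M) = (\<integral>\<^sup>+x. ennreal (normal_density \<mu> \<sigma> x) * indicator ?B x \<partial>lborel)"
      by (rule distributed_emeasure[OF 1(2)]) simp
    moreover have "(\<integral>\<^sup>+x. ennreal (normal_density \<mu> \<sigma> x) * indicator ?B x \<partial>lborel) \<noteq> 0"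
    proof
      assume "(\<integral>\<^sup>+x. ennreal (normal_density \<mu> \<sigma> x) * indicator ?B x \<partial>lborel) = 0"
      then have "AE x in lborel. ennreal (normal_density \<mu> \<sigma> x) * indicator ?B x = 0"
        by (subst (asm) nn_integral_0_iff_AE) auto
      then have "AE x in lborel. x \<notin> ?B"
      proof eventually_elim
        fix x assume "ennreal (normal_density \<mu> \<sigma> x) * indicator ?B x = 0"
        with normal_density_pos[OF 1(1), of \<mu> x] show "x \<notin> ?B"
          by (cases "x \<in> ?B") (simp_all add: ennreal_eq_0_iff)
      qed
      then have "emeasure lborel ?B = 0" by (subst (asm) AE_iff_measurable[where N = ?B]) auto
      then show False using \<open>0 < e\<close> by simp
    qed
    moreover have "X -` ?B \<inter> space M = {\<omega> \<in> space M. \<bar>X \<omega> - y\<bar> < e}" by auto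
    ultimately have "ennreal (prob {\<omega> \<in> space M. \<bar>X \<omega> - y\<bar> < e}) \<noteq> 0"
      by (simp add: emeasure_eq_measure)
    then show ?thesis by (auto simp: zero_less_measure_iff)
  next
    case (2 c)
    have "var X = 0"
      using integral_AE_const[OF meas 2, of "\<lambda>x. x"] integral_AE_const[OF meas 2, of "\<lambda>x. x\<^sup>2"]
      by (simp add: var_def)
    then show ?thesis using v by simp
  qed
qed

lemma linear_family_subspace:
  assumes "subspace V"
  shows "linear_family (blinfun_apply ` (V :: ('a::real_normed_vector \<Rightarrow>\<^sub>L real) set))"
  unfolding linear_family_def
proof (intro conjI ballI allI)
  have "(0 :: 'a \<Rightarrow>\<^sub>L real) \<in> V" using assms by (rule subspace_0)
  moreover have "blinfun_apply (0 :: 'a \<Rightarrow>\<^sub>L real) = (\<lambda>_. 0)" by (rule ext) simp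
  ultimately show "(\<lambda>_. 0) \<in> blinfun_apply ` V" by (metis imageI)
  fix f assume "f \<in> blinfun_apply ` V"
  then obtain L where L: "L \<in> V" "f = blinfun_apply L" by auto
  { fix g assume "g \<in> blinfun_apply ` V"
    then obtain L' where L': "L' \<in> V" "g = blinfun_apply L'" by auto
    have "L + L' \<in> V" using L L' assms by (simp add: subspace_add)
    then show "(\<lambda>x. f x + g x) \<in> blinfun_apply ` V"
      by (rule rev_image_eqI) (auto simp: L L' blinfun.add_left) }
  { fix c
    have "c *\<^sub>R L \<in> V" using L assms by (simp add: subspace_scale)
    then show "(\<lambda>x. c * f x) \<in> blinfun_apply ` V"
      by (rule rev_image_eqI) (auto simp: L blinfun.scaleR_left) }
qed

text \<open>The last assumption, that the bounded functionals generate the Borel sets, holds on every separable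
space; it lets laws and independence be checked on functionals.\<close>

locale gaussian_measure = prob_space \<mu> for \<mu> :: "'a::real_normed_vector measure" +
  assumes sets_eq_borel [measurable_cong]: "sets \<mu> = sets borel"
    and gaussian: "\<And>L :: 'a \<Rightarrow>\<^sub>L real. gaussian_rv \<mu> (blinfun_apply L)"
    and weakly_generated: "events_of borel (range blinfun_apply) = sets (borel :: 'a measure)"
begin

lemma space_eq_UNIV [simp]: "space \<mu> = UNIV"
  using sets_eq_imp_space_eq[OF sets_eq_borel] by simp

lemma measurable_blinfun [measurable]: "blinfun_apply (L :: 'a \<Rightarrow>\<^sub>L real) \<in> borel_measurable \<mu>"
  by (rule gaussian_rv_measurable[OF gaussian])

definition mean :: "('a \<Rightarrow>\<^sub>L real) \<Rightarrow> real" where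
  "mean L = expectation (blinfun_apply L)"

definition cov :: "('a \<Rightarrow>\<^sub>L real) \<Rightarrow> ('a \<Rightarrow>\<^sub>L real) \<Rightarrow> real" where
  "cov L L' = expectation (\<lambda>z. L z * L' z) - mean L * mean L'"

lemma integrable_blinfun: "integrable \<mu> (blinfun_apply (L :: 'a \<Rightarrow>\<^sub>L real))"
  by (rule gaussian_rv_integrable[OF gaussian])

lemma integrable_blinfun_mult: "integrable \<mu> (\<lambda>z. (L :: 'a \<Rightarrow>\<^sub>L real) z * (L' :: 'a \<Rightarrow>\<^sub>L real) z)"
proof -
  note sq = gaussian_rv_integrable_square[OF gaussian]
  have "integrable \<mu> (\<lambda>z. ((L + L') z)\<^sup>2 - (L z)\<^sup>2 - (L' z)\<^sup>2)"
    by (intro Bochner_Integration.integrable_diff sq)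
  then have "integrable \<mu> (\<lambda>z. (((L + L') z)\<^sup>2 - (L z)\<^sup>2 - (L' z)\<^sup>2) / 2)"
    by (rule integrable_divide_zero) 
  then show ?thesis by (simp add: blinfun.add_left power2_eq_square algebra_simps)
qed

lemma mean_add: "mean (L + L') = mean L + mean L'"
  by (simp add: mean_def blinfun.add_left[abs_def] integrable_blinfun)

lemma mean_scaleR: "mean (c *\<^sub>R L) = c * mean L"
  by (simp add: mean_def blinfun.scaleR_left[abs_def])

lemma cov_commute: "cov L L' = cov L' L"
  by (simp add: cov_def mult.commute)

lemma cov_add_left: "cov (L + L') L'' = cov L L'' + cov L' L''"
  by (simp add: cov_def mean_add blinfun.add_left distrib_right integrable_blinfun_mult)

lemma cov_scaleR_left: "cov (c *\<^sub>R L) L' = c * cov L L'"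
  by (simp add: cov_def mean_scaleR blinfun.scaleR_left mult.assoc right_diff_distrib)

lemma linear_mean: "linear mean"
  by (rule linearI) (simp_all add: mean_add mean_scaleR)

lemma linear_cov_left: "linear (\<lambda>L. cov L L')"
  by (rule linearI) (simp_all add: cov_add_left cov_scaleR_left)

lemma linear_cov_right: "linear (cov L)"
proof -
  have "cov L = (\<lambda>L'. cov L' L)" by (rule ext) (rule cov_commute)
  then show ?thesis using linear_cov_left by simp
qed

lemmas cov_diff_left = linear_diff[OF linear_cov_left]
lemmas cov_add_right = linear_add[OF linear_cov_right]
lemmas cov_diff_right = linear_diff[OF linear_cov_right]
lemmas cov_scaleR_right = linear_scale[OF linear_cov_right, unfolded real_scaleR_def]

lemma var_blinfun: "var (blinfun_apply L) = cov L L"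
  by (simp add: var_def cov_def mean_def power2_eq_square)

lemma cov_nonneg: "0 \<le> cov L L"
  using gaussian_rv_var_nonneg[OF gaussian] by (simp add: var_blinfun)

lemma cov_degenerate:
  assumes "cov L L = 0"
  shows "cov L L' = 0"
proof (rule ccontr)
  assume nz: "cov L L' \<noteq> 0"
  define t where "t = - (cov L' L' + 1) / (2 * cov L L')"
  have "0 \<le> cov (L' + t *\<^sub>R L) (L' + t *\<^sub>R L)" by (rule cov_nonneg)
  also have "\<dots> = cov L' L' + 2 * t * cov L L'"
    by (simp add: cov_add_left cov_add_right cov_scaleR_left cov_scaleR_right assms cov_commute[of L' L])
  also have "\<dots> = - 1" using nz by (simp add: t_def field_simps)
  finally show False by simp
qed

lemma cf_blinfun:
  fixes L :: "'a \<Rightarrow>\<^sub>L real"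
  shows "(CLINT z|\<mu>. iexp (L z)) = exp (\<i> * of_real (mean L) - of_real (cov L L / 2))"
  using gaussian_rv_cf[OF gaussian, of 1 L] by (simp add: mean_def var_blinfun)

lemma
  fixes L :: "nat \<Rightarrow> 'a \<Rightarrow>\<^sub>L real"
  assumes "\<And>z. (\<lambda>n. blinfun_apply (L n) z) \<longlonglongrightarrow> blinfun_apply L' z"
  shows mean_LIMSEQ: "(\<lambda>n. mean (L n)) \<longlonglongrightarrow> mean L'"
    and cov_LIMSEQ: "(\<lambda>n. cov (L n) L'') \<longlonglongrightarrow> cov L' L''"
proof -
  show "(\<lambda>n. mean (L n)) \<longlonglongrightarrow> mean L'"
    unfolding mean_def by (rule expectation_gaussian_LIMSEQ) (auto intro: gaussian assms)
  \<comment> \<open>Polarisation reduces the covariance to variances, for which the limit theorem applies.\<close>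
  have polar: "cov L L'' = (cov (L + L'') (L + L'') - cov L L - cov L'' L'') / 2" for L
    by (simp add: cov_add_left cov_add_right cov_commute[of L'' L])
  have 1: "(\<lambda>n. cov (L n) (L n)) \<longlonglongrightarrow> cov L' L'"
    unfolding var_blinfun[symmetric] by (rule var_gaussian_LIMSEQ) (auto intro: gaussian assms)
  have 2: "(\<lambda>n. cov (L n + L'') (L n + L'')) \<longlonglongrightarrow> cov (L' + L'') (L' + L'')"
    unfolding var_blinfun[symmetric]
    by (rule var_gaussian_LIMSEQ) (auto intro!: gaussian assms tendsto_intros simp: blinfun.add_left)
  have "(\<lambda>n. (cov (L n + L'') (L n + L'') - cov (L n) (L n) - cov L'' L'') / 2) \<longlonglongrightarrow>
      (cov (L' + L'') (L' + L'') - cov L' L' - cov L'' L'') / 2"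
    by (intro tendsto_intros 1 2) simp
  then show "(\<lambda>n. cov (L n) L'') \<longlonglongrightarrow> cov L' L''" by (simp only: polar[symmetric])
qed

text \<open>A Gaussian characteristic function is the exponential of mean and variance. Both are additive on
\<open>L + L'\<close> when the covariance vanishes, so the characteristic function factorises.\<close>

theorem uncorrelated_independent:
  assumes "subspace V" "subspace W" and uncorr: "\<And>L L'. L \<in> V \<Longrightarrow> L' \<in> W \<Longrightarrow> cov L L' = 0"
    and A: "A \<in> events_of \<mu> (blinfun_apply ` V)" and B: "B \<in> events_of \<mu> (blinfun_apply ` W)"
  shows "prob (A \<inter> B) = prob A * prob B"
proof (rule linear_families_independent[OF _ _ _ _ _ A B])
  show "blinfun_apply ` V \<subseteq> borel_measurable \<mu>" "blinfun_apply ` W \<subseteq> borel_measurable \<mu>"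
    by (auto intro: measurable_blinfun)
  fix f g assume "f \<in> blinfun_apply ` V" "g \<in> blinfun_apply ` W"
  then obtain L L' where L: "L \<in> V" "f = blinfun_apply L" and L': "L' \<in> W" "g = blinfun_apply L'" by auto
  have "(CLINT z|\<mu>. iexp (f z + g z)) = (CLINT z|\<mu>. iexp ((L + L') z))"
    by (simp add: L L' blinfun.add_left)
  also have "\<dots> = (CLINT z|\<mu>. iexp (f z)) * (CLINT z|\<mu>. iexp (g z))"
    unfolding L L' cf_blinfun mult_exp_exp
    using uncorr[OF L(1) L'(1)] by (simp add: mean_add cov_add_left cov_add_right cov_commute[of L' L] algebra_simps add_divide_distrib)
  finally show "(CLINT z|\<mu>. iexp (f z + g z)) = (CLINT z|\<mu>. iexp (f z)) * (CLINT z|\<mu>. iexp (g z))" .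
qed (use assms in \<open>auto intro: linear_family_subspace\<close>)

text \<open>Induction on the number of functionals: subtracting from the others their regression on \<open>l j\<close> makes
them uncorrelated with, hence independent of \<open>l j\<close>, and keeps the nondegeneracy. The box then
contains an intersection of two independent events of positive probability.\<close>

lemma small_box_pos:
  fixes l :: "'i \<Rightarrow> 'a \<Rightarrow>\<^sub>L real"
  assumes "finite J"
    and nondeg: "\<And>a. \<exists>i\<in>J. a i \<noteq> 0 \<Longrightarrow> 0 < cov (\<Sum>i\<in>J. a i *\<^sub>R l i) (\<Sum>i\<in>J. a i *\<^sub>R l i)"
    and "0 < e"
  shows "0 < prob {z. \<forall>i\<in>J. \<bar>l i z - y i\<bar> < e}"
  using assms
proof (induction J arbitrary: l y e rule: finite_induct)
  case empty
  then show ?case using prob_space by simp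
next
  case (insert j J)
  define c where "c = cov (l j) (l j)"
  have "(\<Sum>i\<in>insert j J. (if i = j then 1 else 0) *\<^sub>R l i) = l j"
    using insert(1,2) by (subst sum.insert) (auto intro!: sum.neutral)
  with insert.prems(1)[of "\<lambda>i. if i = j then 1 else 0"] have c: "0 < c"
    by (simp add: c_def)
  define \<beta> where "\<beta> i = cov (l i) (l j) / c" for i
  define l' where "l' i = l i - \<beta> i *\<^sub>R l j" for i
  define y' where "y' i = y i - \<beta> i * y j" for i
  \<comment> \<open>An error of \<open>d\<close> in \<open>l j\<close> contributes at most \<open>\<bar>\<beta> i\<bar> * d\<close> to that of \<open>l i\<close>.\<close>
  define d where "d = e / (1 + (\<Sum>i\<in>J. \<bar>\<beta> i\<bar>))"
  have pos: "0 < 1 + (\<Sum>i\<in>J. \<bar>\<beta> i\<bar>)" by (intro add_pos_nonneg sum_nonneg) auto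
  have d: "0 < d" "d * (1 + (\<Sum>i\<in>J. \<bar>\<beta> i\<bar>)) = e"
    using \<open>0 < e\<close> pos by (simp_all add: d_def)
  have "0 < prob {z. \<forall>i\<in>J. \<bar>l' i z - y' i\<bar> < d}"
  proof (rule insert.IH[OF _ d(1)])
    fix a assume a: "\<exists>i\<in>J. a i \<noteq> (0::real)"
    \<comment> \<open>These coefficients express a combination of the \<open>l' i\<close> through the original functionals.\<close>
    define b where "b i = (if i = j then - (\<Sum>i\<in>J. a i * \<beta> i) else a i)" for i
    have "(\<Sum>i\<in>insert j J. b i *\<^sub>R l i) = b j *\<^sub>R l j + (\<Sum>i\<in>J. a i *\<^sub>R l i)"
      using insert(1,2) by (subst sum.insert) (auto simp: b_def intro!: sum.cong)
    also have "\<dots> = (\<Sum>i\<in>J. a i *\<^sub>R l' i)"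
      by (simp add: b_def l'_def scaleR_right_diff_distrib sum_subtractf scaleR_sum_left)
    moreover have "\<exists>i\<in>insert j J. b i \<noteq> 0" using a insert(2) by (auto simp: b_def)
    ultimately show "0 < cov (\<Sum>i\<in>J. a i *\<^sub>R l' i) (\<Sum>i\<in>J. a i *\<^sub>R l' i)"
      using insert.prems(1)[of b] by simp
  qed
  moreover have "0 < prob {z. \<bar>l j z - y j\<bar> < d}"
    using gaussian_rv_interval_pos[OF gaussian _ d(1), of "l j" "y j"] c by (simp add: var_blinfun c_def)
  moreover have "prob ({z. \<bar>l j z - y j\<bar> < d} \<inter> {z. \<forall>i\<in>J. \<bar>l' i z - y' i\<bar> < d}) =
      prob {z. \<bar>l j z - y j\<bar> < d} * prob {z. \<forall>i\<in>J. \<bar>l' i z - y' i\<bar> < d}"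
  proof (rule uncorrelated_independent)
    have strip: "{z. \<bar>L z - r\<bar> < d} \<in> events_of \<mu> (blinfun_apply ` V)" if "L \<in> V" for L r and V :: "('a \<Rightarrow>\<^sub>L real) set"
    proof -
      have "{z. \<bar>L z - r\<bar> < d} = blinfun_apply L -` {r - d<..<r + d} \<inter> space \<mu>" by auto
      with that show ?thesis unfolding events_of_def
        by (intro sigma_sets.Basic CollectI exI[of _ "blinfun_apply L"] exI[of _ "{r - d<..<r + d}"]) auto
    qed
    let ?W = "{L. cov (l j) L = 0}"
    show "subspace (span {l j})" by (rule subspace_span)
    show "subspace ?W"
      by (auto intro!: subspaceI simp: cov_add_right cov_scaleR_right linear_0[OF linear_cov_right])
    show "{z. \<bar>l j z - y j\<bar> < d} \<in> events_of \<mu> (blinfun_apply ` span {l j})"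
      by (rule strip) (simp add: span_base)
    have l': "l' i \<in> ?W" for i
      using c by (simp add: l'_def \<beta>_def c_def cov_diff_right cov_scaleR_right cov_commute)
    interpret S: sigma_algebra UNIV "events_of \<mu> (blinfun_apply ` ?W)"
      unfolding events_of_def space_eq_UNIV by (rule sigma_algebra_sigma_sets) auto
    show "{z. \<forall>i\<in>J. \<bar>l' i z - y' i\<bar> < d} \<in> events_of \<mu> (blinfun_apply ` ?W)"
      using S.sets_Collect_finite_All[OF _ insert(1), of "\<lambda>i z. \<bar>l' i z - y' i\<bar> < d"] strip[OF l'] by simp
    fix L L' assume "L \<in> span {l j}" "L' \<in> ?W"
    then show "cov L L' = 0" by (auto simp: span_singleton cov_scaleR_left)
  qed
  ultimately have "0 < prob ({z. \<bar>l j z - y j\<bar> < d} \<inter> {z. \<forall>i\<in>J. \<bar>l' i z - y' i\<bar> < d})"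
    by simp
  also have "\<dots> \<le> prob {z. \<forall>i\<in>insert j J. \<bar>l i z - y i\<bar> < e}"
  proof (rule finite_measure_mono)
    show "{z. \<forall>i\<in>insert j J. \<bar>l i z - y i\<bar> < e} \<in> events"
    proof -
      have "{z \<in> space \<mu>. \<forall>i\<in>insert j J. \<bar>l i z - y i\<bar> < e} \<in> events"
      proof (rule sets.sets_Collect_finite_All)
        show "{z \<in> space \<mu>. \<bar>l i z - y i\<bar> < e} \<in> events" for i by measurable
      qed (use insert(1) in simp)
      then show ?thesis by simp
    qed
    show "{z. \<bar>l j z - y j\<bar> < d} \<inter> {z. \<forall>i\<in>J. \<bar>l' i z - y' i\<bar> < d} \<subseteq> {z. \<forall>i\<in>insert j J. \<bar>l i z - y i\<bar> < e}"
    proof (clarify, elim insertE)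
      fix z i assume zj: "\<bar>l j z - y j\<bar> < d" and zJ: "\<forall>i\<in>J. \<bar>l' i z - y' i\<bar> < d"
      have "0 \<le> (\<Sum>i\<in>J. \<bar>\<beta> i\<bar>)" by (intro sum_nonneg) auto
      then have "d * 1 \<le> e" unfolding d(2)[symmetric] using d(1) by (intro mult_left_mono) auto
      with zj show "\<bar>l i z - y i\<bar> < e" if "i = j" using that by simp
      assume i: "i \<in> J"
      have "\<bar>\<beta> i\<bar> \<le> (\<Sum>i\<in>J. \<bar>\<beta> i\<bar>)" using i insert(1) by (intro member_le_sum) auto
      then have "d * (1 + \<bar>\<beta> i\<bar>) \<le> e" unfolding d(2)[symmetric] using d(1) by (intro mult_left_mono) auto
      moreover have "l i z - y i = (l' i z - y' i) + \<beta> i * (l j z - y j)"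
        by (simp add: l'_def y'_def blinfun.diff_left blinfun.scaleR_left algebra_simps)
      then have "\<bar>l i z - y i\<bar> \<le> \<bar>l' i z - y' i\<bar> + \<bar>\<beta> i\<bar> * \<bar>l j z - y j\<bar>"
        by (metis abs_mult abs_triangle_ineq)
      moreover have "\<bar>\<beta> i\<bar> * \<bar>l j z - y j\<bar> \<le> \<bar>\<beta> i\<bar> * d" using zj by (intro mult_left_mono) auto
      moreover have "\<bar>l' i z - y' i\<bar> < d" using zJ i by blast
      ultimately show "\<bar>l i z - y i\<bar> < e" by (simp add: algebra_simps)
    qed
  qed
  finally show ?case .
qed

end

section \<open>Uniqueness of continuous disintegrations\<close>

lemma borel_measurable_weakI:
  fixes X :: "'b \<Rightarrow> 'a::real_normed_vector"
  assumes gen: "events_of borel (range blinfun_apply) = sets (borel :: 'a measure)"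
    and X: "\<And>L :: 'a \<Rightarrow>\<^sub>L real. (\<lambda>\<omega>. L (X \<omega>)) \<in> borel_measurable M"
  shows "X \<in> borel_measurable M"
proof (rule measurableI)
  fix A :: "'a set" assume "A \<in> sets borel"
  then have "A \<in> events_of borel (range blinfun_apply)" using gen by simp
  then have "X -` A \<inter> space M \<in> events_of M (range (\<lambda>L :: 'a \<Rightarrow>\<^sub>L real. \<lambda>\<omega>. L (X \<omega>)))"
    by (rule vimage_events_of) auto
  also have "\<dots> \<subseteq> sets M" by (rule events_of_subset) (auto intro: X)
  finally show "X -` A \<inter> space M \<in> sets M" .
qed simp

text \<open>The mixture property says that \<open>\<mu>\<close> is the bind of the image law with the kernel; on the fibre over
\<open>y\<close> the factor \<open>g (H z)\<close> is the constant \<open>g y\<close>.\<close>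

lemma disintegration_integral:
  fixes f :: "'a::topological_space \<Rightarrow> real" and g :: "'b::t1_space \<Rightarrow> real"
  assumes dis: "disintegration \<mu> H \<kappa>" and "prob_space \<mu>" and sets: "sets \<mu> = sets borel"
    and H [measurable]: "H \<in> borel_measurable borel"
    and [measurable]: "f \<in> borel_measurable borel" "g \<in> borel_measurable borel"
    and f: "\<And>x. \<bar>f x\<bar> \<le> B" and g: "\<And>y. \<bar>g y\<bar> \<le> C"
  shows "(\<integral>z. g (H z) * f z \<partial>\<mu>) = (\<integral>y. g y * (\<integral>z. f z \<partial>\<kappa> y) \<partial>distr \<mu> borel H)"
proof -
  interpret prob_space \<mu> by fact
  let ?P = "distr \<mu> borel H"
  have H' [measurable]: "H \<in> borel_measurable \<mu>" using sets by (simp cong: measurable_cong_sets)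
  interpret P: prob_space ?P by (rule prob_space_distr) simp
  from dis have \<kappa>: "\<kappa> \<in> borel \<rightarrow>\<^sub>M prob_algebra borel"
    and fibre: "AE y in ?P. emeasure (\<kappa> y) (H -` {y}) = 1"
    and mix: "\<And>A. A \<in> sets borel \<Longrightarrow> emeasure \<mu> A = (\<integral>\<^sup>+ y. emeasure (\<kappa> y) A \<partial>?P)"
    by (auto simp: disintegration_def)
  have \<kappa>_space: "prob_space (\<kappa> y)" "sets (\<kappa> y) = sets borel" for y
    using measurable_space[OF \<kappa>, of y] by (auto simp: space_prob_algebra)
  have \<kappa>_P: "\<kappa> \<in> ?P \<rightarrow>\<^sub>M subprob_algebra borel"
    using measurable_prob_algebraD[OF \<kappa>] by (simp cong: measurable_cong_sets)
  have bind: "\<mu> = ?P \<bind> \<kappa>"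
  proof (rule measure_eqI)
    show "sets \<mu> = sets (?P \<bind> \<kappa>)"
      using sets_bind_measurable[OF \<kappa>_P] sets by simp
    fix A assume "A \<in> sets \<mu>"
    then have A: "A \<in> sets borel" using sets by simp
    show "emeasure \<mu> A = emeasure (?P \<bind> \<kappa>) A"
      using mix[OF A] emeasure_bind[OF _ \<kappa>_P A] by simp
  qed
  have C: "0 \<le> C" using g[of "H undefined"] abs_ge_zero order_trans by blast
  have "(\<integral>z. g (H z) * f z \<partial>\<mu>) = (\<integral>y. \<integral>z. g (H z) * f z \<partial>\<kappa> y \<partial>?P)"
    unfolding bind[symmetric]
    by (subst (1) bind, rule integral_bind[where K = borel and B = "C * B" and B' = 1])
      (auto simp: measurable_prob_algebraD[OF \<kappa>] abs_mult P.finite_measure_axioms prob_space.emeasure_space_1[OF \<kappa>_space(1)] intro!: mult_mono f g C)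
  also have "\<dots> = (\<integral>y. g y * (\<integral>z. f z \<partial>\<kappa> y) \<partial>?P)"
  proof (rule integral_cong_AE)
    have meas: "(\<lambda>y. \<integral>z. h z \<partial>\<kappa> y) \<in> borel_measurable ?P" if "h \<in> borel_measurable borel" for h :: "'a \<Rightarrow> real"
      using measurable_compose[OF \<kappa>_P integral_measurable_subprob_algebra[OF that]] .
    show "(\<lambda>y. \<integral>z. g (H z) * f z \<partial>\<kappa> y) \<in> borel_measurable ?P" by (rule meas) simp
    show "(\<lambda>y. g y * (\<integral>z. f z \<partial>\<kappa> y)) \<in> borel_measurable ?P" using meas[of f] by simp
    show "AE y in ?P. (\<integral>z. g (H z) * f z \<partial>\<kappa> y) = g y * (\<integral>z. f z \<partial>\<kappa> y)"
      using fibre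
    proof eventually_elim
      case (elim y)
      interpret K: prob_space "\<kappa> y" by (rule \<kappa>_space)
      have [measurable_cong]: "sets (\<kappa> y) = sets borel" by (rule \<kappa>_space)
      have "K.prob (H -` {y}) = 1" using elim by (simp add: measure_def)
      moreover have "H -` {y} \<in> sets (\<kappa> y)" using elim emeasure_notin_sets by fastforce
      ultimately have "AE z in \<kappa> y. z \<in> H -` {y}" by (simp add: K.prob_eq_1)
      then have "(\<integral>z. g (H z) * f z \<partial>\<kappa> y) = (\<integral>z. g y * f z \<partial>\<kappa> y)"
        by (intro integral_cong_AE) auto
      then show ?case by simp
    qed
  qed
  finally show ?thesis .
qed

text \<open>For a bounded continuous \<open>f\<close> let \<open>F y\<close> be the difference of its two kernel integrals. Testing both
disintegrations against \<open>F (H z) * f z\<close> shows that \<open>F\<close> has mean square zero under the image law.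
As \<open>F\<close> is continuous and the image law charges every open set, \<open>F\<close> vanishes identically. The choices
\<open>f = cos L\<close> and \<open>f = sin L\<close> then identify the kernels.\<close>

theorem continuous_disintegration_unique:
  fixes \<mu> :: "'a::real_normed_vector measure" and H :: "'a \<Rightarrow> 'b::t1_space"
  assumes \<mu>: "prob_space \<mu>" "sets \<mu> = sets borel"
    and gen: "events_of borel (range blinfun_apply) = sets (borel :: 'a measure)"
    and H: "continuous_on UNIV H"
    and support: "\<And>U. open U \<Longrightarrow> U \<noteq> {} \<Longrightarrow> 0 < measure \<mu> (H -` U)"
    and dis: "disintegration \<mu> H \<kappa>" "disintegration \<mu> H \<kappa>'"
    and cont: "\<And>f :: 'a \<Rightarrow> real. continuous_on UNIV f \<Longrightarrow> bounded (range f) \<Longrightarrow> continuous_on UNIV (\<lambda>y. \<integral>z. f z \<partial>\<kappa> y)"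
      "\<And>f :: 'a \<Rightarrow> real. continuous_on UNIV f \<Longrightarrow> bounded (range f) \<Longrightarrow> continuous_on UNIV (\<lambda>y. \<integral>z. f z \<partial>\<kappa>' y)"
  shows "\<kappa> y = \<kappa>' y"
proof -
  interpret prob_space \<mu> by fact
  have H_meas [measurable]: "H \<in> borel_measurable borel" by (rule borel_measurable_continuous_onI[OF H])
  then have H_meas' [measurable]: "H \<in> borel_measurable \<mu>" using \<mu>(2) by (simp cong: measurable_cong_sets)
  have \<kappa>: "prob_space (\<kappa> y)" "sets (\<kappa> y) = sets borel" "prob_space (\<kappa>' y)" "sets (\<kappa>' y) = sets borel" for y
  proof -
    have "\<kappa> y \<in> space (prob_algebra borel)" "\<kappa>' y \<in> space (prob_algebra borel)"
      using dis unfolding disintegration_def by (auto dest: measurable_space)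
    then show "prob_space (\<kappa> y)" "sets (\<kappa> y) = sets borel" "prob_space (\<kappa>' y)" "sets (\<kappa>' y) = sets borel"
      by (simp_all add: space_prob_algebra)
  qed
  have eq: "(\<integral>z. f z \<partial>\<kappa> y) = (\<integral>z. f z \<partial>\<kappa>' y)"
    if f: "continuous_on UNIV f" "\<And>z. \<bar>f z\<bar> \<le> 1" for f :: "'a \<Rightarrow> real" and y
  proof -
    let ?P = "distr \<mu> borel H"
    define F where "F y = (\<integral>z. f z \<partial>\<kappa> y) - (\<integral>z. f z \<partial>\<kappa>' y)" for y
    have "bounded (range f)" using f(2) by (auto simp: bounded_iff)
    then have F_cont: "continuous_on UNIV F" "continuous_on UNIV (\<lambda>y. \<integral>z. f z \<partial>\<kappa> y)" "continuous_on UNIV (\<lambda>y. \<integral>z. f z \<partial>\<kappa>' y)"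
      unfolding F_def using f(1) cont by (auto intro!: continuous_intros)
    note [measurable] = F_cont[THEN borel_measurable_continuous_onI] borel_measurable_continuous_onI[OF f(1)]
    have bd: "\<bar>\<integral>z. f z \<partial>K\<bar> \<le> 1" if "prob_space K" "sets K = sets borel" for K
    proof -
      interpret K: prob_space K by fact
      have "integrable K f" using f(2) that(2) by (intro K.integrable_const_bound[where B = 1]) (auto cong: measurable_cong_sets)
      then show ?thesis
        using f(2) K.integral_le_const[of f 1] K.integral_ge_const[of f "- 1"] by (simp add: abs_le_iff minus_le_iff)
    qed
    have F_bd: "\<bar>F y\<bar> \<le> 2" for y
      using bd[OF \<kappa>(1,2), of y] bd[OF \<kappa>(3,4), of y] by (simp add: F_def)
    interpret P: prob_space ?P by (rule prob_space_distr) simp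
    have int_mult: "integrable ?P (\<lambda>y. F y * h y)"
      if [measurable]: "h \<in> borel_measurable borel" and h: "\<And>y. \<bar>h y\<bar> \<le> 2" for h
    proof (rule P.integrable_const_bound[where B = "2 * 2"])
      show "AE y in ?P. norm (F y * h y) \<le> 2 * 2"
        unfolding real_norm_def abs_mult using F_bd h by (intro AE_I2 mult_mono) auto
    qed simp
    have le2: "\<bar>\<integral>z. f z \<partial>\<kappa> y\<bar> \<le> 2" "\<bar>\<integral>z. f z \<partial>\<kappa>' y\<bar> \<le> 2" for y
      using bd[OF \<kappa>(1,2), of y] bd[OF \<kappa>(3,4), of y] by simp_all
    have int: "integrable ?P (\<lambda>y. F y * (\<integral>z. f z \<partial>\<kappa> y))" "integrable ?P (\<lambda>y. F y * (\<integral>z. f z \<partial>\<kappa>' y))"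
      "integrable ?P (\<lambda>y. F y * F y)"
      by (rule int_mult; simp add: le2 F_bd)+
    have "(\<integral>y. F y * F y \<partial>?P) = (\<integral>y. F y * (\<integral>z. f z \<partial>\<kappa> y) - F y * (\<integral>z. f z \<partial>\<kappa>' y) \<partial>?P)"
      by (simp add: F_def right_diff_distrib)
    also have "\<dots> = (\<integral>y. F y * (\<integral>z. f z \<partial>\<kappa> y) \<partial>?P) - (\<integral>y. F y * (\<integral>z. f z \<partial>\<kappa>' y) \<partial>?P)"
      by (rule Bochner_Integration.integral_diff[OF int(1,2)])
    also have "\<dots> = 0"
      using disintegration_integral[OF dis(1) \<mu> H_meas _ _ f(2) F_bd] disintegration_integral[OF dis(2) \<mu> H_meas _ _ f(2) F_bd]
      by simp
    finally have "AE y in ?P. F y * F y = 0"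
      by (subst (asm) integral_nonneg_eq_0_iff_AE[OF int(3)]) auto
    then have "AE z in \<mu>. F (H z) * F (H z) = 0"
      by (subst (asm) AE_distr_iff) auto
    moreover have [measurable]: "H -` {y. F y \<noteq> 0} \<in> events"
    proof -
      have "{z \<in> space \<mu>. F (H z) \<noteq> 0} \<in> events" by measurable
      then show ?thesis using sets_eq_imp_space_eq[OF \<mu>(2)] by (simp add: vimage_def)
    qed
    ultimately have "measure \<mu> (H -` {y. F y \<noteq> 0}) = 0"
      by (subst prob_eq_0) (auto elim: eventually_mono)
    moreover have "open {y. F y \<noteq> 0}"
      using open_Collect_neq[OF F_cont(1) continuous_on_const[of UNIV 0]] by simp
    ultimately have "{y. F y \<noteq> 0} = {}" using support[of "{y. F y \<noteq> 0}"] by fastforce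
    then show ?thesis by (auto simp: F_def)
  qed
  have cf: "(CLINT z|\<kappa> y. iexp (L z)) = (CLINT z|\<kappa>' y. iexp (L z))" for L :: "'a \<Rightarrow>\<^sub>L real"
  proof -
    have 1: "(\<integral>z. cos (L z) \<partial>\<kappa> y) = (\<integral>z. cos (L z) \<partial>\<kappa>' y)" "(\<integral>z. sin (L z) \<partial>\<kappa> y) = (\<integral>z. sin (L z) \<partial>\<kappa>' y)"
      by (rule eq; auto intro!: continuous_intros)+
    have 2: "(CLINT z|K. iexp (L z)) = of_real (\<integral>z. cos (L z) \<partial>K) + \<i> * of_real (\<integral>z. sin (L z) \<partial>K)"
      if "prob_space K" "sets K = sets borel" for K
    proof -
      interpret K: prob_space K by fact
      have [measurable]: "blinfun_apply L \<in> borel_measurable K"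
        using borel_measurable_blinfun[of L] that(2) by (simp cong: measurable_cong_sets)
      have "integrable K (\<lambda>z. cos (L z))" "integrable K (\<lambda>z. sin (L z))"
        by (auto intro!: K.integrable_const_bound[where B = 1])
      then show ?thesis
        using K.integral_iexp_weights[where w = "\<lambda>_. 1" and C = 1 and g = L]
        by (simp add: K.prob_space algebra_simps)
    qed
    show ?thesis using 1 2[OF \<kappa>(1,2)] 2[OF \<kappa>(3,4)] by simp
  qed
  interpret K: prob_space "\<kappa> y" by (rule \<kappa>)
  interpret K': prob_space "\<kappa>' y" by (rule \<kappa>)
  show ?thesis
  proof (rule measure_eqI)
    show "sets (\<kappa> y) = sets (\<kappa>' y)" by (simp add: \<kappa>)
    fix A assume "A \<in> sets (\<kappa> y)"
    then have "A \<in> events_of borel (range (blinfun_apply :: _ \<Rightarrow>\<^sub>L real \<Rightarrow> _))" using gen \<kappa>(2) by simp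
    then have "A \<in> events_of (\<kappa> y) (range (blinfun_apply :: _ \<Rightarrow>\<^sub>L real \<Rightarrow> _))"
      using sets_eq_imp_space_eq[OF \<kappa>(2)] by (simp add: events_of_def)
    then have "measure (\<kappa> y) A = measure (\<kappa>' y) A"
    proof (rule linear_family_uniqueness[rotated -1])
      show "linear_family (range (blinfun_apply :: 'a \<Rightarrow>\<^sub>L real \<Rightarrow> _))"
        by (rule linear_family_subspace) simp
      show "range (blinfun_apply :: _ \<Rightarrow>\<^sub>L real \<Rightarrow> _) \<subseteq> borel_measurable (\<kappa> y)"
        using borel_measurable_blinfun \<kappa>(2) by (auto cong: measurable_cong_sets)
    qed (auto simp: cf \<kappa> K.finite_measure_axioms K'.finite_measure_axioms)
    then show "emeasure (\<kappa> y) A = emeasure (\<kappa>' y) A"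
      by (simp add: K.emeasure_eq_measure K'.emeasure_eq_measure)
  qed
qed

section \<open>Disintegration of a Gaussian measure along an observation\<close>

definition obs :: "('a::real_normed_vector \<Rightarrow>\<^sub>L (real ^ 'p::finite)) \<Rightarrow> real ^ 'p \<Rightarrow> 'a \<Rightarrow>\<^sub>L real" where
  "obs H b = blinfun_inner_right b o\<^sub>L H"

lemma obs_apply [simp]: "obs H b z = b \<bullet> H z"
  by (simp add: obs_def)

lemma linear_obs: "linear (obs H)"
  by (rule linearI) (auto intro!: blinfun_eqI simp: inner_add_left blinfun.add_left blinfun.scaleR_left)

definition residual :: "('a::real_normed_vector \<Rightarrow>\<^sub>L (real ^ 'p::finite)) \<Rightarrow> ((real ^ 'p) \<Rightarrow>\<^sub>L 'a) \<Rightarrow> 'a \<Rightarrow>\<^sub>L 'a" where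
  "residual H \<Phi> = id_blinfun - (\<Phi> o\<^sub>L H)"

lemma residual_apply [simp]: "residual H \<Phi> z = z - \<Phi> (H z)"
  by (simp add: residual_def blinfun.diff_left)

context gaussian_measure begin

text \<open>The characteristic function of the image shows its means and variances, and polarisation its
covariances.\<close>

lemma gaussian_affine_image:
  fixes R :: "'a \<Rightarrow>\<^sub>L 'a" and a :: 'a
  defines "\<nu> \<equiv> distr \<mu> borel (\<lambda>z. R z + a)"
  shows "gaussian_measure \<nu>"
    and "gaussian_measure.mean \<nu> L = mean (L o\<^sub>L R) + L a"
    and "gaussian_measure.cov \<nu> L L' = cov (L o\<^sub>L R) (L' o\<^sub>L R)"
proof -
  have [measurable]: "(\<lambda>z. R z + a) \<in> borel_measurable \<mu>"
  proof (rule borel_measurable_weakI[OF weakly_generated])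
    fix L :: "'a \<Rightarrow>\<^sub>L real"
    have "(\<lambda>z. (L o\<^sub>L R) z + L a) \<in> borel_measurable \<mu>" by measurable
    then show "(\<lambda>z. L (R z + a)) \<in> borel_measurable \<mu>" by (simp add: blinfun.add_right)
  qed
  interpret N: prob_space \<nu> unfolding \<nu>_def by (rule prob_space_distr) simp
  have Lm [measurable]: "blinfun_apply L \<in> borel_measurable borel" for L :: "'a \<Rightarrow>\<^sub>L real"
    by (rule borel_measurable_blinfun)
  have law: "gaussian_rv \<nu> (blinfun_apply L) \<and> N.expectation L = mean (L o\<^sub>L R) + L a \<and> N.var L = cov (L o\<^sub>L R) (L o\<^sub>L R)"
    for L :: "'a \<Rightarrow>\<^sub>L real"
  proof -
    have "(CLINT z|\<nu>. iexp (t * L z)) =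
        exp (\<i> * of_real (t * (mean (L o\<^sub>L R) + L a)) - of_real (t\<^sup>2 * cov (L o\<^sub>L R) (L o\<^sub>L R) / 2))" for t
    proof -
      have "(CLINT z|\<nu>. iexp (t * L z)) = (CLINT z|\<mu>. iexp (t * L (R z + a)))"
        unfolding \<nu>_def by (rule integral_distr) simp_all
      also have "\<dots> = (CLINT z|\<mu>. iexp (t * L a) * iexp (t * (L o\<^sub>L R) z))"
        by (simp add: mult_exp_exp blinfun.add_right algebra_simps)
      also have "\<dots> = iexp (t * L a) * (CLINT z|\<mu>. iexp (t * (L o\<^sub>L R) z))"
        by (rule integral_mult_right_zero)
      also have "\<dots> = exp (\<i> * of_real (t * (mean (L o\<^sub>L R) + L a)) - of_real (t\<^sup>2 * cov (L o\<^sub>L R) (L o\<^sub>L R) / 2))"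
        unfolding gaussian_rv_cf[OF gaussian] mult_exp_exp var_blinfun mean_def[symmetric]
        by (simp add: algebra_simps)
      finally show ?thesis .
    qed
    from N.gaussian_rvI_cf[OF _ cov_nonneg this] show ?thesis by (simp add: \<nu>_def)
  qed
  show G: "gaussian_measure \<nu>"
    by unfold_locales (use law weakly_generated in \<open>auto simp: \<nu>_def\<close>)
  then interpret G: gaussian_measure \<nu> .
  show m: "G.mean L = mean (L o\<^sub>L R) + L a" for L using law by (simp add: G.mean_def)
  have v: "G.cov L L = cov (L o\<^sub>L R) (L o\<^sub>L R)" for L using law by (simp add: G.var_blinfun)
  have compose: "(L + L') o\<^sub>L R = (L o\<^sub>L R) + (L' o\<^sub>L R)"
    by (auto intro!: blinfun_eqI simp: blinfun.add_left)
  have "G.cov L L' = (G.cov (L + L') (L + L') - G.cov L L - G.cov L' L') / 2"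
    by (simp add: G.cov_add_left G.cov_add_right G.cov_commute[of L' L])
  also have "\<dots> = cov (L o\<^sub>L R) (L' o\<^sub>L R)"
    by (simp add: v compose cov_add_left cov_add_right cov_commute[of "L' o\<^sub>L R" "L o\<^sub>L R"])
  finally show "G.cov L L' = cov (L o\<^sub>L R) (L' o\<^sub>L R)" .
qed

text \<open>The coordinates of the observation form a nondegenerate family, and every open set contains a box.\<close>

lemma observation_full_support:
  fixes H :: "'a \<Rightarrow>\<^sub>L (real ^ 'p)"
  assumes nondeg: "\<And>b. b \<noteq> 0 \<Longrightarrow> 0 < cov (obs H b) (obs H b)"
    and U: "open U" "U \<noteq> {}"
  shows "0 < prob (H -` U)"
proof -
  obtain y r where "0 < r" and ball: "ball y r \<subseteq> U" using U by (metis ex_in_conv openE)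
  define e where "e = r / CARD('p)"
  have "0 < e" using \<open>0 < r\<close> by (simp add: e_def)
  let ?l = "\<lambda>i. obs H (axis i 1)"
  have sum: "(\<Sum>i\<in>UNIV. a i *\<^sub>R ?l i) = obs H (\<chi> i. a i)" for a :: "'p \<Rightarrow> real"
    by (rule blinfun_eqI) (simp add: blinfun.sum_left blinfun.scaleR_left inner_axis', simp add: inner_vec_def)
  have "0 < prob {z. \<forall>i\<in>UNIV. \<bar>?l i z - y $ i\<bar> < e}"
  proof (rule small_box_pos)
    fix a :: "'p \<Rightarrow> real" assume "\<exists>i\<in>UNIV. a i \<noteq> 0"
    then have "(\<chi> i. a i) \<noteq> 0" by (auto simp: vec_eq_iff)
    then show "0 < cov (\<Sum>i\<in>UNIV. a i *\<^sub>R ?l i) (\<Sum>i\<in>UNIV. a i *\<^sub>R ?l i)"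
      unfolding sum by (rule nondeg)
  qed (use \<open>0 < e\<close> in simp_all)
  also have "\<dots> \<le> prob (H -` U)"
  proof (rule finite_measure_mono)
    show "H -` U \<in> events"
      using measurable_sets[OF borel_measurable_blinfun[of H], of U] U sets_eq_borel by simp
    show "{z. \<forall>i\<in>UNIV. \<bar>?l i z - y $ i\<bar> < e} \<subseteq> H -` U"
    proof clarify
      fix z assume z: "\<forall>i\<in>UNIV. \<bar>?l i z - y $ i\<bar> < e"
      have "norm (H z - y) \<le> (\<Sum>i\<in>UNIV. \<bar>(H z - y) $ i\<bar>)" by (rule norm_le_l1_cart)
      also have "\<dots> < (\<Sum>i\<in>(UNIV :: 'p set). e)"
        using z by (intro sum_strict_mono) (auto simp: inner_axis')
      also have "\<dots> = r" by (simp add: e_def)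
      finally show "z \<in> H -` U" using ball by (auto simp: dist_norm norm_minus_commute)
    qed
  qed
  finally show ?thesis .
qed

lemma events_of_functionals:
  fixes X :: "'a \<Rightarrow> 'b::topological_space"
  assumes gen: "events_of borel V = sets (borel :: 'b measure)" and B: "B \<in> sets borel"
    and X: "\<And>f. f \<in> V \<Longrightarrow> (\<lambda>z. f (X z)) \<in> W"
  shows "X -` B \<in> events_of \<mu> W"
  using vimage_events_of[of B borel V X \<mu> W] assms by simp

lemma residual_observation_independent:
  fixes H :: "'a \<Rightarrow>\<^sub>L (real ^ 'p)" and \<Phi> :: "(real ^ 'p) \<Rightarrow>\<^sub>L 'a"
  assumes uncorr: "\<And>L b. cov (L o\<^sub>L residual H \<Phi>) (obs H b) = 0"
    and A: "A \<in> sets borel" and B: "B \<in> sets borel"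
  shows "prob (H -` A \<inter> residual H \<Phi> -` B) = prob (H -` A) * prob (residual H \<Phi> -` B)"
proof (rule uncorrelated_independent)
  let ?V = "range (obs H)" and ?W = "range (\<lambda>L. L o\<^sub>L residual H \<Phi>) :: ('a \<Rightarrow>\<^sub>L real) set"
  show "subspace ?V" by (rule linear_subspace_image[OF linear_obs subspace_UNIV])
  have "linear (\<lambda>L :: 'a \<Rightarrow>\<^sub>L real. L o\<^sub>L residual H \<Phi>)"
    by (rule linearI) (auto intro!: blinfun_eqI simp: blinfun.add_left blinfun.scaleR_left)
  then show "subspace ?W" by (rule linear_subspace_image[OF _ subspace_UNIV])
  show "H -` A \<in> events_of \<mu> (blinfun_apply ` ?V)"
    by (rule events_of_functionals[OF borel_vec_eq_events_of A]) (auto simp: image_iff fun_eq_iff)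
  show "residual H \<Phi> -` B \<in> events_of \<mu> (blinfun_apply ` ?W)"
    by (rule events_of_functionals[OF weakly_generated B]) (auto simp: image_iff fun_eq_iff)
qed (auto simp: cov_commute[of "obs H _"] uncorr)

text \<open>Since observation and residual are independent, the law of \<open>z = residual z + \<Phi> (H z)\<close> is obtained by
freezing \<open>H z = y\<close> in the second term and integrating over \<open>y\<close>. The frozen variable lies in the fibre
over \<open>y\<close> because \<open>H\<close> annihilates the residual.\<close>

theorem residual_disintegration:
  fixes H :: "'a \<Rightarrow>\<^sub>L (real ^ 'p)" and \<Phi> :: "(real ^ 'p) \<Rightarrow>\<^sub>L 'a"
  assumes right_inverse: "\<And>v. H (\<Phi> v) = v"
    and uncorr: "\<And>L b. cov (L o\<^sub>L residual H \<Phi>) (obs H b) = 0"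
  shows "disintegration \<mu> H (\<lambda>y. distr \<mu> borel (\<lambda>z. residual H \<Phi> z + \<Phi> y))"
    and "\<And>f :: 'a \<Rightarrow> real. continuous_on UNIV f \<Longrightarrow> bounded (range f) \<Longrightarrow>
      continuous_on UNIV (\<lambda>y. \<integral>z. f z \<partial>distr \<mu> borel (\<lambda>z. residual H \<Phi> z + \<Phi> y))"
proof -
  let ?R = "residual H \<Phi>"
  let ?P = "distr \<mu> borel H"
  have H_meas [measurable]: "blinfun_apply H \<in> borel_measurable borel" "blinfun_apply H \<in> borel_measurable \<mu>"
    and R_meas [measurable]: "blinfun_apply ?R \<in> borel_measurable \<mu>"
    using borel_measurable_blinfun[of H] borel_measurable_blinfun[of ?R] sets_eq_borel by (auto cong: measurable_cong_sets)
  have add_meas: "(\<lambda>(y, z). z + \<Phi> y) \<in> borel_measurable (borel \<Otimes>\<^sub>M borel)"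
  proof (rule borel_measurable_weakI[OF weakly_generated])
    fix L :: "'a \<Rightarrow>\<^sub>L real"
    note [measurable] = borel_measurable_blinfun[of L] borel_measurable_blinfun[of "L o\<^sub>L \<Phi>"]
    have "(\<lambda>w. L (snd w) + (L o\<^sub>L \<Phi>) (fst w)) \<in> borel_measurable (borel \<Otimes>\<^sub>M borel)" by measurable
    then show "(\<lambda>w. L (case w of (y, z) \<Rightarrow> z + \<Phi> y)) \<in> borel_measurable (borel \<Otimes>\<^sub>M borel)"
      by (simp add: blinfun.add_right split_beta)
  qed
  have shift [measurable]: "(\<lambda>z. z + \<Phi> y) \<in> borel_measurable borel" for y
    using measurable_compose[OF measurable_Pair1' add_meas, of y] by simp
  have T_meas: "(\<lambda>z. ?R z + \<Phi> y) \<in> borel_measurable \<mu>" for y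
    by (rule measurable_compose[OF R_meas shift])
  have kernel_eq: "distr \<mu> borel (\<lambda>z. ?R z + \<Phi> y) = distr (distr \<mu> borel ?R) borel (\<lambda>z. z + \<Phi> y)" for y
    by (subst distr_distr[OF shift R_meas]) (simp only: comp_def)
  interpret R: prob_space "distr \<mu> borel ?R" by (rule prob_space_distr) simp
  interpret P: prob_space ?P by (rule prob_space_distr) simp
  have kernel: "(\<lambda>y. distr \<mu> borel (\<lambda>z. ?R z + \<Phi> y)) \<in> borel \<rightarrow>\<^sub>M prob_algebra borel"
    unfolding kernel_eq
  proof (rule measurable_distr_prob_space2)
    show "(\<lambda>_. distr \<mu> borel ?R) \<in> borel \<rightarrow>\<^sub>M prob_algebra borel"
      by (rule measurable_const) (simp add: space_prob_algebra R.prob_space_axioms)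
  qed (rule add_meas)
  have fibre: "emeasure (distr \<mu> borel (\<lambda>z. ?R z + \<Phi> y)) (H -` {y}) = 1" for y
  proof -
    have "H -` {y} \<in> sets borel" using measurable_sets[OF H_meas(1), of "{y}"] by simp
    then have "emeasure (distr \<mu> borel (\<lambda>z. ?R z + \<Phi> y)) (H -` {y}) = emeasure \<mu> ((\<lambda>z. ?R z + \<Phi> y) -` (H -` {y}) \<inter> space \<mu>)"
      by (intro emeasure_distr T_meas)
    also have "(\<lambda>z. ?R z + \<Phi> y) -` (H -` {y}) \<inter> space \<mu> = space \<mu>"
      by (auto simp: blinfun.add_right blinfun.diff_right right_inverse)
    finally show ?thesis unfolding emeasure_space_1 .
  qed
  have pair_meas: "(\<lambda>z. (H z, ?R z)) \<in> \<mu> \<rightarrow>\<^sub>M borel \<Otimes>\<^sub>M borel"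
    by (intro measurable_Pair H_meas R_meas)
  have product: "?P \<Otimes>\<^sub>M distr \<mu> borel ?R = distr \<mu> (borel \<Otimes>\<^sub>M borel) (\<lambda>z. (H z, ?R z))"
  proof (rule pair_measure_eqI)
    show "sets (?P \<Otimes>\<^sub>M distr \<mu> borel ?R) = sets (distr \<mu> (borel \<Otimes>\<^sub>M borel) (\<lambda>z. (H z, ?R z)))"
      by (simp cong: sets_pair_measure_cong)
    fix A B assume "A \<in> sets ?P" "B \<in> sets (distr \<mu> borel ?R)"
    then have AB: "A \<in> sets borel" "B \<in> sets borel" by auto
    then have "emeasure ?P A * emeasure (distr \<mu> borel ?R) B = ennreal (prob (H -` A) * prob (?R -` B))"
      by (simp add: emeasure_distr emeasure_eq_measure ennreal_mult)
    also have "\<dots> = emeasure (distr \<mu> (borel \<Otimes>\<^sub>M borel) (\<lambda>z. (H z, ?R z))) (A \<times> B)"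
    proof -
      have "(\<lambda>z. (H z, ?R z)) -` (A \<times> B) \<inter> space \<mu> = H -` A \<inter> ?R -` B" by auto
      then show ?thesis
        using AB residual_observation_independent[OF uncorr AB]
        by (simp add: emeasure_distr[OF pair_meas] emeasure_eq_measure del: residual_apply)
    qed
    finally show "emeasure ?P A * emeasure (distr \<mu> borel ?R) B =
      emeasure (distr \<mu> (borel \<Otimes>\<^sub>M borel) (\<lambda>z. (H z, ?R z))) (A \<times> B)" .
  qed (auto intro: R.sigma_finite_measure_axioms P.sigma_finite_measure_axioms)
  have mixture: "emeasure \<mu> A = (\<integral>\<^sup>+y. emeasure (distr \<mu> borel (\<lambda>z. ?R z + \<Phi> y)) A \<partial>?P)"
    if A: "A \<in> sets borel" for A
  proof -
    let ?S = "(\<lambda>(y, z). z + \<Phi> y) -` A"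
    have S: "?S \<in> sets (borel \<Otimes>\<^sub>M borel)"
      using measurable_sets[OF add_meas A] by (simp add: space_pair_measure)
    have "emeasure \<mu> A = emeasure \<mu> ((\<lambda>z. (H z, ?R z)) -` ?S \<inter> space \<mu>)"
      by (rule arg_cong[where f = "emeasure \<mu>"]) auto
    also have "\<dots> = emeasure (?P \<Otimes>\<^sub>M distr \<mu> borel ?R) ?S"
      unfolding product by (rule emeasure_distr[OF pair_meas S, symmetric])
    also have "\<dots> = (\<integral>\<^sup>+y. emeasure (distr \<mu> borel ?R) (Pair y -` ?S) \<partial>?P)"
      using S by (intro R.emeasure_pair_measure_alt) (simp cong: sets_pair_measure_cong)
    also have "\<dots> = (\<integral>\<^sup>+y. emeasure (distr \<mu> borel (\<lambda>z. ?R z + \<Phi> y)) A \<partial>?P)"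
      unfolding kernel_eq by (intro nn_integral_cong, subst emeasure_distr) (auto simp: A vimage_def)
    finally show ?thesis .
  qed
  show "disintegration \<mu> H (\<lambda>y. distr \<mu> borel (\<lambda>z. ?R z + \<Phi> y))"
    unfolding disintegration_def using kernel fibre mixture by (auto intro!: AE_I2)
  fix f :: "'a \<Rightarrow> real"
  assume f: "continuous_on UNIV f" "bounded (range f)"
  then obtain C where C: "\<And>z. norm (f z) \<le> C" by (auto simp: bounded_iff)
  have [measurable]: "f \<in> borel_measurable borel" by (rule borel_measurable_continuous_onI[OF f(1)])
  have eq: "(\<integral>z. f z \<partial>distr \<mu> borel (\<lambda>z. ?R z + \<Phi> y)) = (\<integral>z. f (?R z + \<Phi> y) \<partial>\<mu>)" for y
    by (intro integral_distr T_meas) simp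
  show "continuous_on UNIV (\<lambda>y. \<integral>z. f z \<partial>distr \<mu> borel (\<lambda>z. ?R z + \<Phi> y))"
    unfolding eq
  proof (rule continuous_on_sequentiallyI)
    fix u :: "nat \<Rightarrow> real ^ 'p" and a assume u: "u \<longlonglongrightarrow> a"
    have f_comp: "(\<lambda>z. f (?R z + \<Phi> y)) \<in> borel_measurable \<mu>" for y
      by (rule measurable_compose[OF T_meas]) simp
    show "(\<lambda>n. \<integral>z. f (?R z + \<Phi> (u n)) \<partial>\<mu>) \<longlonglongrightarrow> (\<integral>z. f (?R z + \<Phi> a) \<partial>\<mu>)"
    proof (rule integral_dominated_convergence[where w = "\<lambda>_. C"])
      have "(\<lambda>n. f (?R z + \<Phi> (u n))) \<longlonglongrightarrow> f (?R z + \<Phi> a)" for z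
        using f(1) by (rule continuous_on_tendsto_compose) (auto intro!: tendsto_intros u)
      then show "AE z in \<mu>. (\<lambda>n. f (?R z + \<Phi> (u n))) \<longlonglongrightarrow> f (?R z + \<Phi> a)" by simp
    qed (use C f_comp in auto)
  qed
qed

end

section \<open>Regression on finitely many observations in C(D)\<close>

lemma bounded_linear_signed_integral:
  fixes l :: "'d::metric_space measure \<times> 'd measure"
  assumes "signed_radon_measure l"
  shows "bounded_linear (\<lambda>f :: 'd \<Rightarrow>\<^sub>C real. signed_integral l (apply_bcontfun f))"
proof -
  have "bounded_linear (\<lambda>f :: 'd \<Rightarrow>\<^sub>C real. \<integral>s. apply_bcontfun f s \<partial>\<nu>)"
    if \<nu>: "sets \<nu> = sets borel" "finite_measure \<nu>" for \<nu> :: "'d measure"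
  proof -
    interpret finite_measure \<nu> by fact
    have bd: "\<bar>apply_bcontfun f s\<bar> \<le> norm f" for f :: "'d \<Rightarrow>\<^sub>C real" and s
      using norm_bounded[of f s] by simp
    have int: "integrable \<nu> (apply_bcontfun f)" for f :: "'d \<Rightarrow>\<^sub>C real"
      using borel_measurable_continuous_onI[OF continuous_on_apply_bcontfun, of f] \<nu>(1) bd
      by (intro integrable_bounded) (auto cong: measurable_cong_sets)
    show ?thesis
    proof (rule bounded_linear_intro[where K = "measure \<nu> (space \<nu>)"])
      fix f :: "'d \<Rightarrow>\<^sub>C real"
      have "norm (\<integral>s. apply_bcontfun f s \<partial>\<nu>) \<le> (\<integral>s. norm (apply_bcontfun f s) \<partial>\<nu>)" by (rule integral_norm_bound)
      also have "\<dots> \<le> (\<integral>s. norm f \<partial>\<nu>)"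
        using bd int by (intro integral_mono) auto
      finally show "norm (\<integral>s. apply_bcontfun f s \<partial>\<nu>) \<le> norm f * measure \<nu> (space \<nu>)"
        by (simp add: mult.commute)
    qed (simp_all add: int)
  qed
  then show ?thesis
    using assms unfolding signed_radon_measure_def signed_integral_def
    by (intro bounded_linear_sub) auto
qed

lemma bounded_linear_integral_operator:
  assumes "\<forall>i. signed_radon_measure (l i)"
  shows "bounded_linear (integral_operator l)"
proof -
  have "bounded_linear (\<lambda>f. \<Sum>i\<in>UNIV. signed_integral (l i) (apply_bcontfun f) *\<^sub>R axis i (1 :: real))"
    using assms by (intro bounded_linear_sum bounded_linear_scaleR_left[THEN bounded_linear_compose]
        bounded_linear_signed_integral) blast
  moreover have "(\<Sum>i\<in>UNIV. signed_integral (l i) (apply_bcontfun f) *\<^sub>R axis i 1) = integral_operator l f" for f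
    by (auto simp: integral_operator_def vec_eq_iff axis_def if_distrib[of "\<lambda>x. _ * x"] cong: if_cong)
  ultimately show ?thesis by simp
qed

lemma eval_eq: "blinfun_apply (eval s) = (\<lambda>f. apply_bcontfun f s)"
  by (rule ext) simp

locale gaussian_bcontfun = gaussian_measure \<mu> for \<mu> :: "('d::metric_space \<Rightarrow>\<^sub>C real) measure" +
  assumes compact: "compact (UNIV :: 'd set)"
begin

lemma mean_fun_eval: "mean_fun \<mu> (\<lambda>s z. apply_bcontfun z s) s = mean (eval s)"
  by (simp add: mean_fun_def mean_def eval_eq)

lemma cov_fun_eval: "cov_fun \<mu> (\<lambda>s z. apply_bcontfun z s) s t = cov (eval s) (eval t)"
  by (simp add: cov_fun_def cov_def mean_def eval_eq)

text \<open>The mean function and the functions \<open>s \<mapsto> cov (Z s) L\<close> as elements of \<open>C(D)\<close>. They are continuous because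
evaluations at convergent points converge pointwise on \<open>C(D)\<close>, and so do their means and covariances.\<close>

definition mean_element :: "'d \<Rightarrow>\<^sub>C real" where
  "mean_element = Bcontfun (\<lambda>s. mean (eval s))"

definition cov_element :: "(('d \<Rightarrow>\<^sub>C real) \<Rightarrow>\<^sub>L real) \<Rightarrow> 'd \<Rightarrow>\<^sub>C real" where
  "cov_element L = Bcontfun (\<lambda>s. cov (eval s) L)"

lemma
  shows mean_element_apply: "apply_bcontfun mean_element s = mean (eval s)"
    and cov_element_apply: "apply_bcontfun (cov_element L) s = cov (eval s) L"
proof -
  have lim: "(\<lambda>n. eval (u n) z) \<longlonglongrightarrow> eval a z" if "u \<longlonglongrightarrow> a" for u a and z :: "'d \<Rightarrow>\<^sub>C real"
    unfolding eval_apply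
    by (rule continuous_on_tendsto_compose[OF continuous_on_apply_bcontfun[of UNIV] that]) auto
  have "continuous_on UNIV (\<lambda>s. mean (eval s))"
    by (rule continuous_on_sequentiallyI) (rule mean_LIMSEQ, rule lim)
  then show "apply_bcontfun mean_element s = mean (eval s)"
    by (simp add: mean_element_def apply_Bcontfun[OF compact])
  have "continuous_on UNIV (\<lambda>s. cov (eval s) L)"
    by (rule continuous_on_sequentiallyI) (rule cov_LIMSEQ, rule lim)
  then show "apply_bcontfun (cov_element L) s = cov (eval s) L"
    by (simp add: cov_element_def apply_Bcontfun[OF compact])
qed

text \<open>Both identities are immediate for combinations of evaluations, and both sides pass to the limit along
the interpolation of \<open>L\<close>.\<close>

lemma
  fixes L :: "('d \<Rightarrow>\<^sub>C real) \<Rightarrow>\<^sub>L real"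
  shows blinfun_mean_element: "L mean_element = mean L"
    and blinfun_cov_element: "L (cov_element L') = cov L L'"
proof -
  obtain S :: "nat \<Rightarrow> 'd set" and \<phi> :: "nat \<Rightarrow> 'd \<Rightarrow> 'd \<Rightarrow>\<^sub>C real"
    where lim: "\<And>f. (\<lambda>n. \<Sum>s\<in>S n. apply_bcontfun f s *\<^sub>R \<phi> n s) \<longlonglongrightarrow> f"
    using bcontfun_interpolation[OF compact] by metis
  define l where "l n = (\<Sum>s\<in>S n. L (\<phi> n s) *\<^sub>R eval s)" for n
  have l: "(\<lambda>n. l n z) \<longlonglongrightarrow> L z" for z
  proof -
    have "l n z = L (\<Sum>s\<in>S n. apply_bcontfun z s *\<^sub>R \<phi> n s)" for n
      by (simp add: l_def blinfun.sum_left blinfun.scaleR_left blinfun.sum_right blinfun.scaleR_right mult.commute)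
    then show ?thesis by (simp only:) (intro tendsto_intros lim)
  qed
  have "l n mean_element = mean (l n)" for n
    by (simp add: l_def blinfun.sum_left blinfun.scaleR_left mean_element_apply linear_sum[OF linear_mean] mean_scaleR)
  then show "L mean_element = mean L"
    using LIMSEQ_unique[OF l[of mean_element]] mean_LIMSEQ[OF l] by simp
  have "l n (cov_element L') = cov (l n) L'" for n
    by (simp add: l_def blinfun.sum_left blinfun.scaleR_left cov_element_apply linear_sum[OF linear_cov_left] cov_scaleR_left)
  then show "L (cov_element L') = cov L L'"
    using LIMSEQ_unique[OF l[of "cov_element L'"]] cov_LIMSEQ[OF l, of L'] by simp
qed

text \<open>These are the row \<open>K_{sH}\<close> and the matrix \<open>K_{HH}\<close>, with an arbitrary functional in the place of the
evaluation at \<open>s\<close>.\<close>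

definition cross_cov :: "(('d \<Rightarrow>\<^sub>C real) \<Rightarrow>\<^sub>L (real ^ 'p::finite)) \<Rightarrow> (('d \<Rightarrow>\<^sub>C real) \<Rightarrow>\<^sub>L real) \<Rightarrow> real ^ 'p" where
  "cross_cov H L = (\<chi> i. cov (obs H (axis i 1)) L)"

definition obs_cov :: "(('d \<Rightarrow>\<^sub>C real) \<Rightarrow>\<^sub>L (real ^ 'p::finite)) \<Rightarrow> real ^ 'p ^ 'p" where
  "obs_cov H = (\<chi> i j. cov (obs H (axis i 1)) (obs H (axis j 1)))"

lemma obs_axis: "(H :: ('d \<Rightarrow>\<^sub>C real) \<Rightarrow>\<^sub>L (real ^ 'p)) f $ i = obs H (axis i 1) f"
  by (simp add: inner_axis')

lemma cov_vec_eq: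
  "cov_vec (cov_fun \<mu> (\<lambda>s z. apply_bcontfun z s)) (blinfun_apply H) s = cross_cov H (eval s)"
proof -
  have "Bcontfun (\<lambda>t. cov (eval t) (eval s)) = cov_element (eval s)" by (simp add: cov_element_def)
  then show ?thesis
    by (simp add: cov_vec_def cross_cov_def cov_fun_eval obs_axis blinfun_cov_element del: obs_apply)
qed

lemma cov_mat_eq:
  "cov_mat (cov_fun \<mu> (\<lambda>s z. apply_bcontfun z s)) (blinfun_apply H) = obs_cov H"
proof -
  have "Bcontfun (\<lambda>s. cov (eval s) L) = cov_element L" "Bcontfun (\<lambda>s. cov L (eval s)) = cov_element L" for L
    by (simp_all add: cov_element_def cov_commute[of L])
  then show ?thesis
    by (simp add: cov_mat_def obs_cov_def cov_fun_eval obs_axis blinfun_cov_element vec_eq_iff del: obs_apply)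
qed

lemma obs_expand: "obs H b = (\<Sum>i\<in>UNIV. b $ i *\<^sub>R obs H (axis i 1))"
  by (rule blinfun_eqI) (simp add: blinfun.sum_left blinfun.scaleR_left inner_axis', simp add: inner_vec_def)

lemma inner_cross_cov: "b \<bullet> cross_cov H L = cov (obs H b) L"
  by (subst obs_expand) (simp add: inner_vec_def cross_cov_def linear_sum[OF linear_cov_left] cov_scaleR_left)

lemma obs_cov_mult: "obs_cov H *v b = cross_cov H (obs H b)"
  by (subst obs_expand) (simp add: vec_eq_iff matrix_vector_mult_def obs_cov_def cross_cov_def
      linear_sum[OF linear_cov_right] cov_scaleR_right mult.commute)

text \<open>The regression operator \<open>v \<mapsto> K_{\<cdot>H} K_{HH}^{-1} v\<close>, known as the gain in filtering.\<close>

definition gain :: "(('d \<Rightarrow>\<^sub>C real) \<Rightarrow>\<^sub>L (real ^ 'p::finite)) \<Rightarrow> (real ^ 'p) \<Rightarrow>\<^sub>L ('d \<Rightarrow>\<^sub>C real)" where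
  "gain H = Blinfun (\<lambda>v. \<Sum>i\<in>UNIV. (matrix_inv (obs_cov H) *v v) $ i *\<^sub>R cov_element (obs H (axis i 1)))"

lemma blinfun_gain: "L (gain H v) = cross_cov H L \<bullet> (matrix_inv (obs_cov H) *v v)"
  for L :: "('d \<Rightarrow>\<^sub>C real) \<Rightarrow>\<^sub>L real"
proof -
  have "linear (\<lambda>v. \<Sum>i\<in>UNIV. (matrix_inv (obs_cov H) *v v) $ i *\<^sub>R cov_element (obs H (axis i 1)))"
    by (rule linearI) (simp_all add: matrix_vector_right_distrib scaleR_left_distrib sum.distrib
        matrix_vector_mult_scaleR scaleR_sum_right)
  then show ?thesis
    by (simp add: gain_def bounded_linear_Blinfun_apply linear_linear blinfun.sum_right blinfun.scaleR_right
        blinfun_cov_element inner_vec_def cross_cov_def cov_commute[of L] mult.commute del: obs_apply)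
qed

end

locale invertible_observation = gaussian_bcontfun \<mu> for \<mu> :: "('d::metric_space \<Rightarrow>\<^sub>C real) measure" +
  fixes H :: "('d \<Rightarrow>\<^sub>C real) \<Rightarrow>\<^sub>L (real ^ 'p::finite)"
  assumes invertible: "invertible (obs_cov H)"
begin

abbreviation "R \<equiv> residual H (gain H)"

lemma inv_cancel: "matrix_inv (obs_cov H) *v (obs_cov H *v b) = b" "obs_cov H *v (matrix_inv (obs_cov H) *v b) = b"
proof -
  have "obs_cov H ** matrix_inv (obs_cov H) = mat 1 \<and> matrix_inv (obs_cov H) ** obs_cov H = mat 1"
    using invertible unfolding invertible_def matrix_inv_def by (rule someI_ex)
  then show "matrix_inv (obs_cov H) *v (obs_cov H *v b) = b" "obs_cov H *v (matrix_inv (obs_cov H) *v b) = b"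
    by (simp_all add: matrix_vector_mul_assoc)
qed

lemma gain_right_inverse: "H (gain H v) = v"
proof (rule vector_eq_rdot[THEN iffD1], rule allI)
  fix a
  have "H (gain H v) \<bullet> a = obs H a (gain H v)" by (simp add: inner_commute)
  also have "\<dots> = cov (obs H a) (obs H (matrix_inv (obs_cov H) *v v))"
    by (simp add: blinfun_gain inner_commute inner_cross_cov cov_commute del: obs_apply)
  also have "\<dots> = v \<bullet> a"
    by (simp add: inner_cross_cov[symmetric] obs_cov_mult[symmetric] inv_cancel inner_commute)
  finally show "H (gain H v) \<bullet> a = v \<bullet> a" .
qed

text \<open>Under any functional the recovered part is again a scalar observation, with coefficients
\<open>cross_cov H L\<close> times the inverse matrix; the covariances below follow from this form.\<close>

lemma compose_residual: "L o\<^sub>L R = L - obs H (cross_cov H L v* matrix_inv (obs_cov H))"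
  for L :: "('d \<Rightarrow>\<^sub>C real) \<Rightarrow>\<^sub>L real"
  by (rule blinfun_eqI) (simp add: blinfun.diff_left blinfun.diff_right blinfun_gain dot_lmul_matrix)

lemma residual_uncorrelated: "cov (L o\<^sub>L R) (obs H b) = 0"
proof -
  have "cov (obs H (cross_cov H L v* matrix_inv (obs_cov H))) (obs H b) = cross_cov H L \<bullet> b"
    by (simp add: inner_cross_cov[symmetric] obs_cov_mult[symmetric] dot_lmul_matrix inv_cancel)
  also have "\<dots> = cov L (obs H b)"
    by (simp add: inner_commute inner_cross_cov cov_commute)
  finally show ?thesis by (simp add: compose_residual cov_diff_left)
qed

lemma cov_residual_right: "cov (L o\<^sub>L R) (L' o\<^sub>L R) = cov (L o\<^sub>L R) L'"
  by (subst (2) compose_residual) (simp add: cov_diff_right residual_uncorrelated)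

text \<open>The Schur complement of \<open>K_{HH}\<close>: regression lowers covariances by what the observation explains.\<close>

lemma cov_residual:
  "cov (L o\<^sub>L R) (L' o\<^sub>L R) = cov L L' - cross_cov H L \<bullet> (matrix_inv (obs_cov H) *v cross_cov H L')"
  unfolding cov_residual_right
  by (simp add: compose_residual cov_diff_left inner_cross_cov[symmetric] dot_lmul_matrix)

text \<open>A scalar observation without variance is uncorrelated with everything, so its coefficients lie in
the kernel of the covariance matrix.\<close>

lemma obs_nondegenerate:
  assumes "b \<noteq> 0"
  shows "0 < cov (obs H b) (obs H b)"
proof (rule ccontr)
  assume "\<not> 0 < cov (obs H b) (obs H b)"
  then have "cov (obs H b) (obs H b) = 0" using cov_nonneg[of "obs H b"] by simp
  then have "cov (obs H a) (obs H b) = 0" for a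
    using cov_degenerate by (subst cov_commute) blast
  then have "obs_cov H *v b = 0"
    unfolding obs_cov_mult cross_cov_def by (simp only: vec_eq_iff vec_lambda_beta zero_index) simp
  then show False using inv_cancel(1)[of b] assms by simp
qed

end

lemma gaussian_rv_distr:
  assumes X: "X \<in> M \<rightarrow>\<^sub>M N" and [measurable]: "f \<in> borel_measurable N"
    and g: "gaussian_rv M (\<lambda>\<omega>. f (X \<omega>))"
  shows "gaussian_rv (distr M N X) f"
proof -
  note [measurable] = X
  have "distr (distr M N X) lborel f = distr M lborel (\<lambda>\<omega>. f (X \<omega>))"
    by (subst distr_distr) (auto simp: comp_def)
  moreover have "(AE z in distr M N X. f z = c) \<longleftrightarrow> (AE \<omega> in M. f (X \<omega>) = c)" for c
    by (rule AE_distr_iff) measurable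
  ultimately show ?thesis
    using g by (auto simp: gaussian_rv_def distributed_def)
qed

text \<open>Bounded functionals of the trajectory are pointwise limits of finite combinations of the \<open>Z s\<close>.\<close>

theorem
  fixes Z :: "'d::metric_space \<Rightarrow> 'w \<Rightarrow> real"
  assumes compact: "compact (UNIV :: 'd set)" and Z: "gaussian_process M Z"
    and cont: "\<forall>\<omega>\<in>space M. continuous_on UNIV (\<lambda>s. Z s \<omega>)"
  shows gaussian_process_law: "gaussian_bcontfun (process_law M Z)"
    and mean_fun_process_law: "mean_fun (process_law M Z) (\<lambda>s z. apply_bcontfun z s) = mean_fun M Z"
    and cov_fun_process_law: "cov_fun (process_law M Z) (\<lambda>s z. apply_bcontfun z s) = cov_fun M Z"
proof -
  interpret prob_space M using Z by (simp add: gaussian_process_def)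
  define X where "X \<omega> = Bcontfun (\<lambda>s. Z s \<omega>)" for \<omega>
  have law: "process_law M Z = distr M borel X" by (simp add: process_law_def X_def[abs_def])
  have X_apply: "apply_bcontfun (X \<omega>) s = Z s \<omega>" if "\<omega> \<in> space M" for \<omega> s
    using cont that by (simp add: X_def apply_Bcontfun[OF compact])
  have Z_sum: "gaussian_rv M (\<lambda>\<omega>. \<Sum>s\<in>S. a s * Z s \<omega>)" if "finite S" for S a
    using Z that by (simp add: gaussian_process_def)
  have Z_meas [measurable]: "Z s \<in> borel_measurable M" for s
    using gaussian_rv_measurable[OF Z_sum[of "{s}" "\<lambda>_. 1"]] by simp
  have X_meas [measurable]: "X \<in> borel_measurable M"
    by (rule borel_measurable_bcontfunI[OF compact]) (simp add: X_apply cong: measurable_cong)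
  obtain S :: "nat \<Rightarrow> 'd set" and \<phi> :: "nat \<Rightarrow> 'd \<Rightarrow> 'd \<Rightarrow>\<^sub>C real"
    where fin: "\<And>n. finite (S n)" and lim: "\<And>f. (\<lambda>n. \<Sum>s\<in>S n. apply_bcontfun f s *\<^sub>R \<phi> n s) \<longlonglongrightarrow> f"
    using bcontfun_interpolation[OF compact] by metis
  have L_gaussian: "gaussian_rv M (\<lambda>\<omega>. L (X \<omega>))" for L :: "('d \<Rightarrow>\<^sub>C real) \<Rightarrow>\<^sub>L real"
  proof (rule gaussian_rv_LIMSEQ)
    show "gaussian_rv M (\<lambda>\<omega>. \<Sum>s\<in>S n. L (\<phi> n s) * Z s \<omega>)" for n by (rule Z_sum[OF fin])
    fix \<omega> assume \<omega>: "\<omega> \<in> space M"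
    have "(\<lambda>n. L (\<Sum>s\<in>S n. apply_bcontfun (X \<omega>) s *\<^sub>R \<phi> n s)) \<longlonglongrightarrow> L (X \<omega>)"
      by (intro tendsto_intros lim)
    then show "(\<lambda>n. \<Sum>s\<in>S n. L (\<phi> n s) * Z s \<omega>) \<longlonglongrightarrow> L (X \<omega>)"
      by (simp add: blinfun.sum_right blinfun.scaleR_right X_apply[OF \<omega>] mult.commute)
  qed
  interpret N: prob_space "process_law M Z" unfolding law by (rule prob_space_distr) simp
  show "gaussian_bcontfun (process_law M Z)"
  proof unfold_locales
    show "sets (process_law M Z) = sets borel" by (simp add: law)
    show "gaussian_rv (process_law M Z) (blinfun_apply L)" for L :: "('d \<Rightarrow>\<^sub>C real) \<Rightarrow>\<^sub>L real"
      unfolding law by (rule gaussian_rv_distr[OF X_meas borel_measurable_blinfun L_gaussian])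
  qed (rule borel_bcontfun_eq_events_of[OF compact], rule compact)
  have eval_meas [measurable]: "(\<lambda>z :: 'd \<Rightarrow>\<^sub>C real. apply_bcontfun z s) \<in> borel_measurable borel" for s
    using borel_measurable_blinfun[of "eval s"] by (simp only: eval_eq)
  have E1: "(\<integral>z. apply_bcontfun z s \<partial>process_law M Z) = (\<integral>\<omega>. Z s \<omega> \<partial>M)" for s
    unfolding law by (subst integral_distr) (auto intro!: Bochner_Integration.integral_cong simp: X_apply)
  have E2: "(\<integral>z. apply_bcontfun z s * apply_bcontfun z t \<partial>process_law M Z) = (\<integral>\<omega>. Z s \<omega> * Z t \<omega> \<partial>M)" for s t
    unfolding law by (subst integral_distr) (auto intro!: Bochner_Integration.integral_cong simp: X_apply)
  show "mean_fun (process_law M Z) (\<lambda>s z. apply_bcontfun z s) = mean_fun M Z"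
    by (rule ext) (simp only: mean_fun_def E1)
  show "cov_fun (process_law M Z) (\<lambda>s z. apply_bcontfun z s) = cov_fun M Z"
    by (intro ext) (simp only: cov_fun_def E1 E2)
qed

text \<open>By uniqueness, whichever weakly continuous version \<^const>\<open>cond_law\<close> selects is the residual
disintegration.\<close>

theorem cond_law_residual:
  fixes H :: "('d::metric_space \<Rightarrow>\<^sub>C real) \<Rightarrow>\<^sub>L (real ^ 'p::finite)"
    and \<Phi> :: "(real ^ 'p) \<Rightarrow>\<^sub>L ('d \<Rightarrow>\<^sub>C real)"
  assumes "gaussian_measure (process_law M Z)"
    and nondeg: "\<And>b. b \<noteq> 0 \<Longrightarrow> 0 < gaussian_measure.cov (process_law M Z) (obs H b) (obs H b)"
    and right_inverse: "\<And>v. H (\<Phi> v) = v"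
    and uncorr: "\<And>L b. gaussian_measure.cov (process_law M Z) (L o\<^sub>L residual H \<Phi>) (obs H b) = 0"
  shows "is_cond_law M Z H (cond_law M Z H)"
    and "cond_law M Z H y = distr (process_law M Z) borel (\<lambda>z. residual H \<Phi> z + \<Phi> y)"
proof -
  interpret gaussian_measure "process_law M Z" by fact
  let ?\<kappa> = "\<lambda>y. distr (process_law M Z) borel (\<lambda>z. residual H \<Phi> z + \<Phi> y)"
  note dis = residual_disintegration[OF right_inverse uncorr]
  have \<kappa>: "is_cond_law M Z H ?\<kappa>"
    unfolding is_cond_law_def using dis by (auto simp del: residual_apply)
  then show c: "is_cond_law M Z H (cond_law M Z H)"
    unfolding cond_law_def by (rule someI[where P = "is_cond_law M Z H"])
  show "cond_law M Z H y = ?\<kappa> y"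
  proof (rule continuous_disintegration_unique[where H = "blinfun_apply H" and \<kappa>' = ?\<kappa>,
        OF prob_space_axioms sets_eq_borel weakly_generated])
    show "continuous_on UNIV (blinfun_apply H)"
      by (intro linear_continuous_on blinfun.bounded_linear_right)
    show "0 < prob (H -` U)" if "open U" "U \<noteq> {}" for U
      using nondeg that by (rule observation_full_support)
  qed (use c \<kappa> in \<open>auto simp: is_cond_law_def simp del: residual_apply\<close>)
qed

section \<open>Observing in two stages\<close>

definition left_vec :: "real ^ ('p::finite + 'q::finite) \<Rightarrow> real ^ 'p" where
  "left_vec v = (\<chi> i. v $ Inl i)"

definition right_vec :: "real ^ ('p::finite + 'q::finite) \<Rightarrow> real ^ 'q" where
  "right_vec v = (\<chi> i. v $ Inr i)"

lemma join_vec_parts [simp]: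
  "left_vec (join_vec u v) = u" "right_vec (join_vec u v) = v" "join_vec (left_vec w) (right_vec w) = w"
  by (auto simp: left_vec_def right_vec_def join_vec_def vec_eq_iff split: sum.split)

lemma linear_left_vec: "linear left_vec" and linear_right_vec: "linear right_vec"
  by (auto intro!: linearI simp: left_vec_def right_vec_def vec_eq_iff)

lemma inner_join_vec:
  fixes u :: "real ^ 'p::finite" and v :: "real ^ 'q::finite"
  shows "b \<bullet> join_vec u v = left_vec b \<bullet> u + right_vec b \<bullet> v"
  unfolding inner_vec_def UNIV_Plus_UNIV[symmetric]
  by (subst sum.Plus) (auto simp: join_vec_def left_vec_def right_vec_def)

definition joint_obs :: "('a::real_normed_vector \<Rightarrow>\<^sub>L (real ^ 'p::finite)) \<Rightarrow> ('a \<Rightarrow>\<^sub>L (real ^ 'q::finite)) \<Rightarrow>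
    'a \<Rightarrow>\<^sub>L (real ^ ('p + 'q))" where
  "joint_obs H1 H2 = Blinfun (\<lambda>z. join_vec (H1 z) (H2 z))"

lemma joint_obs_apply [simp]: "joint_obs H1 H2 z = join_vec (H1 z) (H2 z)"
proof -
  have "linear (\<lambda>p :: (real ^ 'p) \<times> (real ^ 'q). join_vec (fst p) (snd p))"
    by (auto intro!: linearI simp: join_vec_def vec_eq_iff split: sum.split)
  then have "bounded_linear (\<lambda>p :: (real ^ 'p) \<times> (real ^ 'q). join_vec (fst p) (snd p))"
    by (simp add: linear_linear)
  from bounded_linear_compose[OF this bounded_linear_Pair[OF blinfun.bounded_linear_right[of H1] blinfun.bounded_linear_right[of H2]]]
  show ?thesis by (simp add: joint_obs_def bounded_linear_Blinfun_apply)
qed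

lemma obs_joint_obs: "obs (joint_obs H1 H2) b = obs H1 (left_vec b) + obs H2 (right_vec b)"
  by (rule blinfun_eqI) (simp add: inner_join_vec blinfun.add_left)

text \<open>Residual maps now occur inside the law \<open>\<nu>\<close> on which the second-stage operators depend, and should
not be expanded there.\<close>

declare residual_apply [simp del]

text \<open>The second observation is made under the law conditioned on the first one having the value \<open>y1\<close>.\<close>

locale two_stage_observation = first: invertible_observation \<mu> H1
  for \<mu> :: "('d::metric_space \<Rightarrow>\<^sub>C real) measure" and H1 :: "('d \<Rightarrow>\<^sub>C real) \<Rightarrow>\<^sub>L (real ^ 'p1::finite)" +
  fixes H2 :: "('d \<Rightarrow>\<^sub>C real) \<Rightarrow>\<^sub>L (real ^ 'p2::finite)" and y1 :: "real ^ 'p1"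
  assumes second_stage: "invertible_observation (distr \<mu> borel (\<lambda>z. first.R z + first.gain H1 y1)) H2"
begin

abbreviation "\<nu> \<equiv> distr \<mu> borel (\<lambda>z. first.R z + first.gain H1 y1)"

sublocale second: invertible_observation \<nu> H2
  by (rule second_stage)

abbreviation "\<Phi>1 \<equiv> first.gain H1"
abbreviation "\<Phi>2 \<equiv> second.gain H2"

lemma second_mean: "second.mean L = first.mean (L o\<^sub>L first.R) + L (\<Phi>1 y1)"
  and second_cov: "second.cov L L' = first.cov (L o\<^sub>L first.R) (L' o\<^sub>L first.R)"
  using first.gaussian_affine_image by simp_all

lemma obs_residual: "obs H1 a o\<^sub>L first.R = 0"
  by (rule blinfun_eqI) (simp add: residual_apply blinfun.diff_right first.gain_right_inverse)

text \<open>After the first stage the functionals of the first observation are constant, so nothing is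
correlated with them.\<close>

lemma first_second_gain: "H1 (\<Phi>2 w) = 0"
proof (rule vector_eq_rdot[THEN iffD1], rule allI)
  fix a
  have "second.cov L (obs H1 a) = 0" for L
    by (simp add: second_cov obs_residual linear_0[OF first.linear_cov_right])
  then have "second.cross_cov H2 (obs H1 a) = 0"
    by (simp add: second.cross_cov_def vec_eq_iff)
  then have "obs H1 a (\<Phi>2 w) = 0" by (simp add: second.blinfun_gain del: obs_apply)
  then show "H1 (\<Phi>2 w) \<bullet> a = 0 \<bullet> a" by (simp add: inner_commute)
qed

text \<open>The second operator corrects only for the part of the second observation that the first one does not
already predict.\<close>

definition joint_gain :: "(real ^ ('p1 + 'p2)) \<Rightarrow>\<^sub>L ('d \<Rightarrow>\<^sub>C real)" where
  "joint_gain = Blinfun (\<lambda>v. \<Phi>1 (left_vec v) + \<Phi>2 (right_vec v - H2 (\<Phi>1 (left_vec v))))"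

lemma joint_gain_apply: "joint_gain v = \<Phi>1 (left_vec v) + \<Phi>2 (right_vec v - H2 (\<Phi>1 (left_vec v)))"
proof -
  have "linear (\<lambda>v. \<Phi>1 (left_vec v) + \<Phi>2 (right_vec v - H2 (\<Phi>1 (left_vec v))))"
    by (rule linearI) (simp_all add: linear_add[OF linear_left_vec] linear_add[OF linear_right_vec]
        linear_scale[OF linear_left_vec] linear_scale[OF linear_right_vec]
        blinfun.add_right blinfun.diff_right blinfun.scaleR_right algebra_simps)
  then show ?thesis by (simp add: joint_gain_def bounded_linear_Blinfun_apply linear_linear)
qed

lemma joint_gain_right_inverse: "joint_obs H1 H2 (joint_gain v) = v"
proof -
  have "H1 (joint_gain v) = left_vec v" "H2 (joint_gain v) = right_vec v"
    by (simp_all add: joint_gain_apply blinfun.add_right blinfun.diff_right first_second_gain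
        first.gain_right_inverse second.gain_right_inverse)
  then show ?thesis by simp
qed

lemma joint_residual: "residual (joint_obs H1 H2) joint_gain = second.R o\<^sub>L first.R"
  by (rule blinfun_eqI) (simp add: joint_gain_apply residual_apply[of H1] residual_apply[of H2] residual_apply[of "joint_obs H1 H2"] blinfun.diff_right algebra_simps)

text \<open>Subtracting the first-stage prediction does not change covariances with first-stage residuals, so
correlation with the second observation can be computed under the conditioned law.\<close>

lemma joint_residual_uncorrelated:
  "first.cov (L o\<^sub>L residual (joint_obs H1 H2) joint_gain) (obs (joint_obs H1 H2) b) = 0"
proof -
  have eq: "L o\<^sub>L residual (joint_obs H1 H2) joint_gain = (L o\<^sub>L second.R) o\<^sub>L first.R"
    by (rule blinfun_eqI) (simp add: joint_residual)
  have "first.cov ((L o\<^sub>L second.R) o\<^sub>L first.R) (obs H2 c) = 0" for c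
    using second.residual_uncorrelated[of L c] by (simp only: second_cov first.cov_residual_right)
  then show ?thesis
    unfolding eq obs_joint_obs first.cov_add_right by (simp add: first.residual_uncorrelated)
qed

text \<open>A combination of both observations without variance is uncorrelated with the first-stage residual of
its second part, which is therefore without variance under the conditioned law. Hence the second part
vanishes, and then so does the first.\<close>

lemma joint_obs_nondegenerate:
  assumes "b \<noteq> 0"
  shows "0 < first.cov (obs (joint_obs H1 H2) b) (obs (joint_obs H1 H2) b)"
proof (rule ccontr)
  assume "\<not> 0 < first.cov (obs (joint_obs H1 H2) b) (obs (joint_obs H1 H2) b)"
  then have "first.cov (obs (joint_obs H1 H2) b) (obs (joint_obs H1 H2) b) = 0"
    using first.cov_nonneg[of "obs (joint_obs H1 H2) b"] by simp
  then have degenerate: "first.cov (obs (joint_obs H1 H2) b) L = 0" for L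
    by (rule first.cov_degenerate)
  let ?l2 = "obs H2 (right_vec b)"
  have "first.cov (obs H1 (left_vec b)) (?l2 o\<^sub>L first.R) = 0"
    using first.residual_uncorrelated by (subst first.cov_commute)
  then have "first.cov (obs (joint_obs H1 H2) b) (?l2 o\<^sub>L first.R) = first.cov ?l2 (?l2 o\<^sub>L first.R)"
    unfolding obs_joint_obs first.cov_add_left by simp
  also have "\<dots> = second.cov ?l2 ?l2"
    unfolding second_cov first.cov_residual_right by (rule first.cov_commute)
  finally have "second.cov ?l2 ?l2 = 0" by (simp only: degenerate)
  then have "right_vec b = 0"
    using second.obs_nondegenerate[of "right_vec b"] by force
  then have "obs (joint_obs H1 H2) b = obs H1 (left_vec b)"
    by (simp add: obs_joint_obs linear_0[OF linear_obs])
  then have "left_vec b = 0"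
    using first.obs_nondegenerate[of "left_vec b"] degenerate[of "obs H1 (left_vec b)"] by force
  with \<open>right_vec b = 0\<close> have "b = join_vec 0 0" by (metis join_vec_parts(3))
  also have "\<dots> = 0" by (simp add: join_vec_def vec_eq_iff split: sum.split)
  finally show False using assms by simp
qed

lemma second_mean_element: "second.mean_element = first.mean_element + \<Phi>1 (y1 - H1 first.mean_element)"
proof (rule bcontfun_eqI)
  fix s
  have "apply_bcontfun second.mean_element s = (eval s o\<^sub>L first.R) first.mean_element + eval s (\<Phi>1 y1)"
    by (simp only: second.mean_element_apply second_mean first.blinfun_mean_element)
  then show "apply_bcontfun second.mean_element s =
      apply_bcontfun (first.mean_element + \<Phi>1 (y1 - H1 first.mean_element)) s"
    by (simp add: residual_apply blinfun.diff_right)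
qed

lemma joint_mean:
  "first.mean (L o\<^sub>L residual (joint_obs H1 H2) joint_gain) + L (joint_gain (join_vec y1 y2)) =
    first.mean L
    + first.cross_cov H1 L \<bullet> (matrix_inv (first.obs_cov H1) *v (y1 - H1 first.mean_element))
    + second.cross_cov H2 L \<bullet> (matrix_inv (second.obs_cov H2) *v (y2 - H2 second.mean_element))"
  unfolding first.blinfun_mean_element[symmetric] first.blinfun_gain[symmetric]
    second.blinfun_gain[symmetric] second_mean_element
  by (simp add: residual_apply joint_gain_apply blinfun.add_right blinfun.diff_right)

lemma joint_cov:
  "first.cov (L o\<^sub>L residual (joint_obs H1 H2) joint_gain) (L' o\<^sub>L residual (joint_obs H1 H2) joint_gain) =
    first.cov L L'
    - first.cross_cov H1 L \<bullet> (matrix_inv (first.obs_cov H1) *v first.cross_cov H1 L')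
    - second.cross_cov H2 L \<bullet> (matrix_inv (second.obs_cov H2) *v second.cross_cov H2 L')"
proof -
  have assoc: "L o\<^sub>L residual (joint_obs H1 H2) joint_gain = (L o\<^sub>L second.R) o\<^sub>L first.R" for L :: "('d \<Rightarrow>\<^sub>C real) \<Rightarrow>\<^sub>L real"
    by (rule blinfun_eqI) (simp add: joint_residual)
  show ?thesis
    unfolding assoc second_cov[symmetric] second.cov_residual
    by (simp only: second_cov first.cov_residual)
qed

end

theorem corollary6:
  fixes M :: "'w measure"
    and Z :: "'d::metric_space \<Rightarrow> 'w \<Rightarrow> real"
    and l1 :: "'p1::finite \<Rightarrow> 'd measure \<times> 'd measure"
    and l2 :: "'p2::finite \<Rightarrow> 'd measure \<times> 'd measure"
    and G1 :: "('d \<Rightarrow>\<^sub>C real) \<Rightarrow> real ^ 'p1"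
    and G2 :: "('d \<Rightarrow>\<^sub>C real) \<Rightarrow> real ^ 'p2"
    and G :: "('d \<Rightarrow>\<^sub>C real) \<Rightarrow> real ^ ('p1 + 'p2)"
    and m m1 :: "'d \<Rightarrow> real"
    and k k1 :: "'d \<Rightarrow> 'd \<Rightarrow> real"
    and y1 :: "real ^ 'p1" and y2 :: "real ^ 'p2"
    and s s1 s2 :: 'd
  assumes "compact (UNIV :: 'd set)"
    and "gaussian_process M Z"
    and "\<forall>\<omega>\<in>space M. continuous_on UNIV (\<lambda>s. Z s \<omega>)"
    and "\<forall>i. signed_radon_measure (l1 i)"
    and "\<forall>i. signed_radon_measure (l2 i)"
    and "m = mean_fun M Z"
    and "k = cov_fun M Z"
    and "G1 = integral_operator l1"
    and "G2 = integral_operator l2"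
    and "G = (\<lambda>f. join_vec (G1 f) (G2 f))"
    and "m1 = cond_mean M Z G1 y1"
    and "k1 = cond_cov M Z G1 y1"
    and "invertible (cov_mat k G1)"
    and "invertible (cov_mat k1 G2)"
  shows "is_cond_law M Z G (cond_law M Z G) \<and>
    cond_mean M Z G (join_vec y1 y2) s =
      m s
      + cov_vec k G1 s \<bullet> (matrix_inv (cov_mat k G1) *v (y1 - G1 (Bcontfun m)))
      + cov_vec k1 G2 s \<bullet> (matrix_inv (cov_mat k1 G2) *v (y2 - G2 (Bcontfun m1))) \<and>
    cond_cov M Z G (join_vec y1 y2) s1 s2 =
      k s1 s2
      - cov_vec k G1 s1 \<bullet> (matrix_inv (cov_mat k G1) *v cov_vec k G1 s2)
      - cov_vec k1 G2 s1 \<bullet> (matrix_inv (cov_mat k1 G2) *v cov_vec k1 G2 s2)"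
proof -
  let ?\<mu> = "process_law M Z"
  note process = assms(1-3)
  define H1 where "H1 = Blinfun G1"
  define H2 where "H2 = Blinfun G2"
  have H1: "blinfun_apply H1 = G1"
    unfolding H1_def assms(8) by (rule bounded_linear_Blinfun_apply[OF bounded_linear_integral_operator[OF assms(4)]])
  have H2: "blinfun_apply H2 = G2"
    unfolding H2_def assms(9) by (rule bounded_linear_Blinfun_apply[OF bounded_linear_integral_operator[OF assms(5)]])
  have H: "blinfun_apply (joint_obs H1 H2) = G"
    unfolding assms(10) H1[symmetric] H2[symmetric] by (rule ext) simp
  have m: "m = mean_fun ?\<mu> (\<lambda>s z. apply_bcontfun z s)" and k: "k = cov_fun ?\<mu> (\<lambda>s z. apply_bcontfun z s)"
    using mean_fun_process_law[OF process] cov_fun_process_law[OF process] assms(6,7) by simp_all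
  interpret A: gaussian_bcontfun ?\<mu> by (rule gaussian_process_law[OF process])
  have cov_mat1: "cov_mat k G1 = A.obs_cov H1" unfolding k H1[symmetric] by (rule A.cov_mat_eq)
  interpret first: invertible_observation ?\<mu> H1
    by unfold_locales (use assms(13) cov_mat1 in simp)
  let ?\<nu> = "distr ?\<mu> borel (\<lambda>z. first.R z + A.gain H1 y1)"
  have cond1: "cond_law M Z G1 y1 = ?\<nu>"
    unfolding H1[symmetric]
    by (rule cond_law_residual(2)[OF A.gaussian_measure_axioms first.obs_nondegenerate
          first.gain_right_inverse first.residual_uncorrelated])
  interpret N: gaussian_bcontfun ?\<nu>
    by (rule gaussian_bcontfun.intro[OF A.gaussian_affine_image(1)])
      (rule gaussian_bcontfun_axioms.intro[OF assms(1)])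
  have m1: "m1 = mean_fun ?\<nu> (\<lambda>s z. apply_bcontfun z s)" and k1: "k1 = cov_fun ?\<nu> (\<lambda>s z. apply_bcontfun z s)"
    unfolding assms(11,12) cond_mean_def cond_cov_def cond1 by (rule refl)+
  have cov_mat2: "cov_mat k1 G2 = N.obs_cov H2" unfolding k1 H2[symmetric] by (rule N.cov_mat_eq)
  interpret two_stage_observation ?\<mu> H1 H2 y1
    by unfold_locales (use assms(14) cov_mat2 in simp)
  let ?\<kappa> = "distr ?\<mu> borel (\<lambda>z. residual (joint_obs H1 H2) joint_gain z + joint_gain (join_vec y1 y2))"
  have joint: "is_cond_law M Z G (cond_law M Z G)" "cond_law M Z G (join_vec y1 y2) = ?\<kappa>"
    unfolding H[symmetric]
    by (rule cond_law_residual[OF A.gaussian_measure_axioms joint_obs_nondegenerate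
          joint_gain_right_inverse joint_residual_uncorrelated], assumption)+
  interpret K: gaussian_bcontfun ?\<kappa>
    by (rule gaussian_bcontfun.intro[OF A.gaussian_affine_image(1)])
      (rule gaussian_bcontfun_axioms.intro[OF assms(1)])
  have m_eval: "m t = A.mean (eval t)" for t
    unfolding m by (rule A.mean_fun_eval)
  have elements: "Bcontfun m = A.mean_element" "Bcontfun m1 = N.mean_element"
    unfolding m m1 A.mean_fun_eval N.mean_fun_eval A.mean_element_def N.mean_element_def by (rule refl)+
  have vecs: "cov_vec k G1 = (\<lambda>s. A.cross_cov H1 (eval s))" "cov_vec k1 G2 = (\<lambda>s. N.cross_cov H2 (eval s))"
    unfolding k k1 H1[symmetric] H2[symmetric] by (rule ext, rule A.cov_vec_eq, rule ext, rule N.cov_vec_eq)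
  have mean: "cond_mean M Z G (join_vec y1 y2) s =
      m s
      + cov_vec k G1 s \<bullet> (matrix_inv (cov_mat k G1) *v (y1 - G1 (Bcontfun m)))
      + cov_vec k1 G2 s \<bullet> (matrix_inv (cov_mat k1 G2) *v (y2 - G2 (Bcontfun m1)))"
  proof -
    have "cond_mean M Z G (join_vec y1 y2) s = K.mean (eval s)"
      unfolding cond_mean_def joint(2) by (rule K.mean_fun_eval)
    also have "\<dots> = A.mean (eval s o\<^sub>L residual (joint_obs H1 H2) joint_gain) + eval s (joint_gain (join_vec y1 y2))"
      by (rule A.gaussian_affine_image(2))
    also note joint_mean
    finally show ?thesis
      unfolding elements vecs cov_mat1 cov_mat2 H1 H2 m_eval .
  qed
  have cov: "cond_cov M Z G (join_vec y1 y2) s1 s2 =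
      k s1 s2
      - cov_vec k G1 s1 \<bullet> (matrix_inv (cov_mat k G1) *v cov_vec k G1 s2)
      - cov_vec k1 G2 s1 \<bullet> (matrix_inv (cov_mat k1 G2) *v cov_vec k1 G2 s2)"
  proof -
    have "cond_cov M Z G (join_vec y1 y2) s1 s2 = K.cov (eval s1) (eval s2)"
      unfolding cond_cov_def joint(2) by (rule K.cov_fun_eval)
    also have "\<dots> = A.cov (eval s1 o\<^sub>L residual (joint_obs H1 H2) joint_gain) (eval s2 o\<^sub>L residual (joint_obs H1 H2) joint_gain)"
      by (rule A.gaussian_affine_image(3))
    also note joint_cov
    finally show ?thesis
      unfolding vecs cov_mat1 cov_mat2 by (simp only: k A.cov_fun_eval)
  qed
  show ?thesis using joint(1) mean cov by blast
qed

end
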